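(* Let $1 \leq \lambda_1 < \lambda_2 < \cdots$ be an increasing sequence of real numbers tending to infinity, let $\{a_n\}_{n\ge 1}$ be a sequence of non-negative real numbers, and let $A(s)=\sum_{n\ge 1} a_n\lambda_n^{-s}$. Let $\alpha>0$ be real and $m\geq 1$ an integer. Assume that $A(s)$ converges for $\Re(s)>\alpha$ and that in this region $$A(s)=\frac{g(s)}{(s-\alpha)^m}+h(s),$$ where $g$ is a polynomial of degree at most $m-1$ with $g(\alpha)\neq 0$, and $h$ is holomorphic in $\Re(s)>\alpha$ and continuous in $\Re(s)\geq\alpha$. Then $$\sum_{\lambda_n\leq x} a_n \sim c\,x^{\alpha}(\log x)^{m-1}\qquad\text{as } x\to\infty,$$ in which $$c=\lim_{s\to\alpha}\frac{(s-\alpha)^mA(s)}{\alpha\,(m-1)!}.$$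
   Context: By convention $(m-1)!=1$ if $m=1$. The phrase "$h$ is holomorphic in $\Re(s)>\alpha$ and continuous in $\Re(s)\ge\alpha$" means $h$ extends continuously from the open half-plane to the closed half-plane. The notation $f(x)\sim g(x)$ as $x\to\infty$ means $f(x)=g(x)+o(g(x))$. *)

theory Defs
  imports
    "HOL-Complex_Analysis.Complex_Analysis"
    "HOL-Computational_Algebra.Polynomial"
    "HOL-Library.Landau_Symbols"
begin

text \<open>
  Sequences are indexed from 0: \<open>a 0, a 1, \<dots>\<close> stand for $a_1, a_2, \ldots$, and likewise for
  the frequencies \<open>l\<close>. Since all frequencies will be at least 1, \<open>powr\<close> below is the usual
  power with the real logarithm of the base.
\<close>

definition dirichlet_term :: "(nat \<Rightarrow> real) \<Rightarrow> (nat \<Rightarrow> real) \<Rightarrow> complex \<Rightarrow> nat \<Rightarrow> complex" where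
  "dirichlet_term a l s n = complex_of_real (a n) * complex_of_real (l n) powr (- s)"

definition dirichlet_sum :: "(nat \<Rightarrow> real) \<Rightarrow> (nat \<Rightarrow> real) \<Rightarrow> complex \<Rightarrow> complex" where
  "dirichlet_sum a l s = (\<Sum>n. dirichlet_term a l s n)"

text \<open>
  ``Continuous in the closed half-plane'' means that the restriction of \<open>h\<close> to the open half-plane
  extends continuously; the values of the total function \<open>h\<close> on the boundary line are irrelevant.
\<close>

definition holomorphic_with_continuous_extension :: "real \<Rightarrow> (complex \<Rightarrow> complex) \<Rightarrow> bool" where
  "holomorphic_with_continuous_extension \<alpha> h \<longleftrightarrow>
     h holomorphic_on {s. Re s > \<alpha>} \<and>
     (\<exists>H. continuous_on {s. Re s \<ge> \<alpha>} H \<and> (\<forall>s. Re s > \<alpha> \<longrightarrow> H s = h s))"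

end

theory Submission
  imports Defs "HOL-Probability.Probability" "HOL-Real_Asymp.Real_Asymp"
begin

text \<open>
  Put \<open>\<tau> n = ln (l n)\<close> and \<open>b n = a n * l n powr (- \<alpha>)\<close>, so that \<open>A (\<alpha> + z)\<close> is the Laplace transform
  of the discrete measure with masses \<open>b n\<close> at \<open>\<tau> n\<close>. The function \<open>k y = (max 0 (1 - \<bar>y\<bar>))\<^sup>2\<close> has
  the strictly positive integrable Fourier transform \<open>K u = 4 * (u - sin u) / u ^ 3\<close>. Integrating
  \<open>k y * cis (T * (y + \<xi>))\<close> against \<open>A (\<alpha> + 1 / T + \<i> * (y + \<xi>))\<close> gives the sum of
  \<open>b n * exp (- \<tau> n / T) * K (T - \<tau> n) * cis (\<xi> * (T - \<tau> n))\<close>. On the analytic side, \<open>1 / z ^ (j + 1)\<close>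
  is the Laplace transform of \<open>t ^ j / j!\<close>, so by dominated convergence a pole of order \<open>j + 1\<close>
  contributes \<open>T ^ j / (e * j!)\<close> times the Fourier transform of \<open>K\<close> at \<open>\<xi>\<close>, asymptotically; the
  continuous part contributes \<open>o(1)\<close> by the Riemann-Lebesgue lemma. Moving to the boundary at speed
  \<open>1 / T\<close> makes all these integrals converge although \<open>t ^ j * K (T - t)\<close> need not be integrable.

  Hence the characteristic functions of the normalised weights \<open>b n * exp (- \<tau> n / T) * K (T - \<tau> n)\<close>,
  placed at \<open>T - \<tau> n\<close>, converge to that of the density proportional to \<open>K\<close>, and Levy's continuity
  theorem gives weak convergence. Testing it on \<open>exp (- \<alpha> * u) / K u\<close> for \<open>u \<ge> 0\<close> (and 0 for
  \<open>u < 0\<close>) yields the asymptotics of the sum of \<open>a n\<close> over \<open>\<tau> n \<le> T\<close>.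
\<close>

section \<open>A positive kernel with compactly supported Fourier transform\<close>

text \<open>Squaring the tent is what removes zeros on the Fourier side: the transform of the plain
  tent is the Fejer kernel, which vanishes at infinitely many points, whereas the proof eventually
  divides by the kernel.\<close>

definition squared_tent :: "real \<Rightarrow> real" where
  "squared_tent y = (max 0 (1 - \<bar>y\<bar>))\<^sup>2"

text \<open>The value \<open>2/3\<close> at 0 fills the removable singularity; it is the integral of
  \<open>squared_tent\<close>.\<close>

definition tent_kernel :: "real \<Rightarrow> real" where
  "tent_kernel u = (if u = 0 then 2/3 else 4 * (u - sin u) / u ^ 3)"

lemma squared_tent_nonneg [simp]: "0 \<le> squared_tent y"
  by (simp add: squared_tent_def)

lemma squared_tent_le: "squared_tent y \<le> indicator {-1..1} y"
proof (cases "\<bar>y\<bar> \<le> 1")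
  case True
  then have "(1 - \<bar>y\<bar>)\<^sup>2 \<le> 1\<^sup>2" by (intro power_mono) auto
  with True show ?thesis by (auto simp: squared_tent_def indicator_def abs_le_iff max_def)
next
  case False
  then show ?thesis by (auto simp: squared_tent_def indicator_def)
qed

lemma squared_tent_le_1: "squared_tent y \<le> 1"
  by (rule order_trans[OF squared_tent_le]) (simp add: indicator_def)

lemma squared_tent_eq_0: "\<bar>y\<bar> \<ge> 1 \<Longrightarrow> squared_tent y = 0"
  by (simp add: squared_tent_def)

lemma continuous_on_squared_tent [continuous_intros]:
  "continuous_on A f \<Longrightarrow> continuous_on A (\<lambda>x. squared_tent (f x))"
  unfolding squared_tent_def by (intro continuous_intros)

lemma squared_tent_measurable [measurable]: "squared_tent \<in> borel_measurable borel"
  by (intro borel_measurable_continuous_onI continuous_intros)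

lemma cis_measurable [measurable]: "cis \<in> borel_measurable borel"
  by (intro borel_measurable_continuous_onI continuous_intros)

lemma integrable_squared_tent_mult:
  fixes f :: "real \<Rightarrow> complex"
  assumes [measurable]: "f \<in> borel_measurable borel"
    and B: "\<And>y. \<bar>y\<bar> \<le> 1 \<Longrightarrow> norm (f y) \<le> B"
  shows "integrable lborel (\<lambda>y. of_real (squared_tent y) * f y)"
proof (rule Bochner_Integration.integrable_bound)
  show "integrable lborel (\<lambda>y. B * indicator {-1..1::real} y)" by simp
  show "AE y in lborel. norm (of_real (squared_tent y) * f y) \<le> norm (B * indicator {-1..1} y)"
  proof (intro AE_I2)
    fix y :: real
    show "norm (of_real (squared_tent y) * f y) \<le> norm (B * indicator {-1..1} y)"
    proof (cases "\<bar>y\<bar> \<le> 1")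
      case True
      have "squared_tent y * norm (f y) \<le> 1 * B"
        using B[OF True] by (intro mult_mono squared_tent_le_1) auto
      with True show ?thesis by (auto simp: norm_mult abs_le_iff)
    next
      case False
      then show ?thesis by (auto simp: squared_tent_eq_0)
    qed
  qed
qed auto

text \<open>The squared tent is a quadratic polynomial on each side of 0, so both halves have
  explicit antiderivatives. These divide by \<open>\<i> * u\<close>, hence the separate case
  \<open>u = 0\<close>.\<close>

lemma fourier_squared_tent:
  "(\<integral>y. of_real (squared_tent y) * cis (u * y) \<partial>lborel) = of_real (tent_kernel u)"
proof -
  define L where "L y = (1 - of_real y)\<^sup>2 * cis (u * y)" for y
  define R where "R y = (1 + of_real y)\<^sup>2 * cis (u * y)" for y
  have cL: "continuous_on A L" and cR: "continuous_on A R" for A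
    by (auto simp: L_def R_def intro!: continuous_intros)
  have [measurable]: "L \<in> borel_measurable borel" "R \<in> borel_measurable borel"
    by (intro borel_measurable_continuous_onI cL cR)+
  have "(\<integral>y. of_real (squared_tent y) * cis (u * y) \<partial>lborel)
     = (\<integral>y. indicator {0..1} y *\<^sub>R L y + indicator {-1..0} y *\<^sub>R R y \<partial>lborel)"
  proof (rule integral_cong_AE)
    \<comment> \<open>The two closed intervals overlap in 0, where the decomposition fails; this
      point is a null set.\<close>
    show "AE y in lborel. of_real (squared_tent y) * cis (u * y) =
        indicator {0..1} y *\<^sub>R L y + indicator {-1..0} y *\<^sub>R R y"
      using AE_lborel_singleton[of 0]
    proof eventually_elim
      case (elim y)
      then show ?case by (auto simp: squared_tent_def L_def R_def indicator_def max_def)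
    qed
  qed auto
  also have "\<dots> = (\<integral>y. indicator {0..1} y *\<^sub>R L y \<partial>lborel) + (\<integral>y. indicator {-1..0} y *\<^sub>R R y \<partial>lborel)"
    by (intro Bochner_Integration.integral_add borel_integrable_compact cL cR) auto
  also have "\<dots> = of_real (tent_kernel u)"
  proof (cases "u = 0")
    case True
    have "(\<integral>y. indicator {0..1} y *\<^sub>R L y \<partial>lborel) = -((1 - of_real 1)^3/3) - (-((1 - of_real 0)^3/3))"
      by (rule integral_FTC_atLeastAtMost[OF _ _ cL])
         (auto simp: L_def True power2_eq_square
               intro!: derivative_eq_intros has_vector_derivative_real_field[of "\<lambda>z. -((1 - z)^3/3)"])
    moreover have "(\<integral>y. indicator {-1..0} y *\<^sub>R R y \<partial>lborel) = (1 + of_real 0)^3/3 - (1 + of_real (-1))^3/3"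
      by (rule integral_FTC_atLeastAtMost[OF _ _ cR])
         (auto simp: R_def True power2_eq_square
               intro!: derivative_eq_intros has_vector_derivative_real_field[of "\<lambda>z. (1 + z)^3/3"])
    ultimately show ?thesis using True by (simp add: tent_kernel_def)
  next
    case False
    define v where "v = \<i> * of_real u"
    have v: "v \<noteq> 0" using False by (simp add: v_def)
    have cis: "cis (u * y) = exp (v * of_real y)" for y
      by (simp add: cis_conv_exp v_def mult_ac)
    \<comment> \<open>\<open>F\<close> and \<open>G\<close> arise from \<open>L\<close> and
      \<open>R\<close> by integrating by parts twice.\<close>
    define F where "F y = exp (v * of_real y) * ((1 - of_real y)\<^sup>2 / v + 2 * (1 - of_real y) / v^2 + 2 / v^3)" for y :: real
    define G where "G y = exp (v * of_real y) * ((1 + of_real y)\<^sup>2 / v - 2 * (1 + of_real y) / v^2 + 2 / v^3)" for y :: real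
    have F: "(F has_vector_derivative L y) (at y within A)" for y A
      unfolding F_def L_def cis
      by (rule has_vector_derivative_real_field[of "\<lambda>z. exp (v * z) * ((1 - z)\<^sup>2 / v + 2 * (1 - z) / v^2 + 2 / v^3)"])
         (use v in \<open>auto intro!: derivative_eq_intros simp: field_simps power2_eq_square power3_eq_cube\<close>)
    have G: "(G has_vector_derivative R y) (at y within A)" for y A
      unfolding G_def R_def cis
      by (rule has_vector_derivative_real_field[of "\<lambda>z. exp (v * z) * ((1 + z)\<^sup>2 / v - 2 * (1 + z) / v^2 + 2 / v^3)"])
         (use v in \<open>auto intro!: derivative_eq_intros simp: field_simps power2_eq_square power3_eq_cube\<close>)
    have "(\<integral>y. indicator {0..1} y *\<^sub>R L y \<partial>lborel) = F 1 - F 0"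
      by (rule integral_FTC_atLeastAtMost[OF _ _ cL]) (auto intro: F)
    moreover have "(\<integral>y. indicator {-1..0} y *\<^sub>R R y \<partial>lborel) = G 0 - G (-1)"
      by (rule integral_FTC_atLeastAtMost[OF _ _ cR]) (auto intro: G)
    moreover have "F 1 - F 0 + (G 0 - G (-1)) = 2 * (exp v - exp (- v)) / v^3 - 4 / v^2"
      using v by (simp add: F_def G_def field_simps)
    moreover have "exp v - exp (-v) = 2 * \<i> * of_real (sin u)"
      by (simp add: v_def sin_of_real[symmetric] sin_exp_eq mult_ac)
    moreover have "2 * (2 * \<i> * of_real (sin u)) / v^3 - 4 / v^2 = of_real (tent_kernel u)"
      using False by (simp add: v_def tent_kernel_def power_mult_distrib power3_eq_cube power2_eq_square field_simps)
    ultimately show ?thesis by simp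
  qed
  finally show ?thesis .
qed

lemma sin_less_self:
  fixes x :: real assumes "0 < x" shows "sin x < x"
proof (cases "x < pi")
  case True
  have "0 - sin 0 < x - sin x"
    using assms
  proof (rule DERIV_pos_imp_increasing_open[of 0 x "\<lambda>x. x - sin x"])
    fix y assume y: "0 < y" "y < x"
    have "cos y < cos 0" by (rule cos_monotone_0_pi) (use y True in auto)
    then show "\<exists>d. ((\<lambda>x. x - sin x) has_real_derivative d) (at y) \<and> 0 < d"
      by (intro exI[of _ "1 - cos y"]) (auto intro!: derivative_eq_intros)
  qed (auto intro!: continuous_intros)
  then show ?thesis by simp
next
  case False
  then show ?thesis using sin_le_one[of x] pi_gt3 by linarith
qed

lemma tent_kernel_minus [simp]: "tent_kernel (- u) = tent_kernel u"
  by (simp add: tent_kernel_def field_simps)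

lemma tent_kernel_abs [simp]: "tent_kernel \<bar>u\<bar> = tent_kernel u"
  by (simp add: abs_if)

text \<open>Evenness reduces the claim to non-negative arguments, where it is
  \<open>sin v < v\<close> or the value at 0.\<close>

lemma tent_kernel_pos [simp]: "0 < tent_kernel u"
proof -
  have "0 < tent_kernel \<bar>u\<bar>"
    using sin_less_self[of "\<bar>u\<bar>"] unfolding tent_kernel_def by auto
  then show ?thesis by simp
qed

lemma tent_kernel_nonneg [simp]: "0 \<le> tent_kernel u"
  using tent_kernel_pos[of u] by linarith

lemma tent_kernel_nonzero [simp]: "tent_kernel u \<noteq> 0"
  using tent_kernel_pos[of u] by linarith

lemma tent_kernel_measurable [measurable]: "tent_kernel \<in> borel_measurable borel"
  unfolding tent_kernel_def[abs_def] by measurable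

text \<open>Dominated convergence in the Fourier integral gives continuity everywhere at once,
  including at the removable singularity.\<close>

lemma isCont_tent_kernel: "isCont tent_kernel u"
proof -
  have "((\<lambda>x. \<integral>y. of_real (squared_tent y) * cis (x * y) \<partial>lborel) \<longlongrightarrow>
         (\<integral>y. of_real (squared_tent y) * cis (u * y) \<partial>lborel)) (at u)"
    unfolding tendsto_at_iff_sequentially comp_def
  proof (intro allI impI)
    fix X :: "nat \<Rightarrow> real" assume X: "X \<longlonglongrightarrow> u"
    show "(\<lambda>i. \<integral>y. of_real (squared_tent y) * cis (X i * y) \<partial>lborel) \<longlonglongrightarrow>
          (\<integral>y. of_real (squared_tent y) * cis (u * y) \<partial>lborel)"
    proof (rule integral_dominated_convergence)
      show "AE y in lborel. (\<lambda>i. of_real (squared_tent y) * cis (X i * y)) \<longlonglongrightarrow> of_real (squared_tent y) * cis (u * y)"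
        by (intro AE_I2 tendsto_intros X)
      show "integrable lborel (\<lambda>y. indicator {-1..1::real} y :: real)" by simp
      show "AE y in lborel. norm (of_real (squared_tent y) * cis (X i * y)) \<le> (indicator {-1..1::real} y :: real)" for i
        using squared_tent_le by (intro AE_I2) (simp add: norm_mult)
    qed measurable
  qed
  then have "((\<lambda>x. of_real (tent_kernel x) :: complex) \<longlongrightarrow> of_real (tent_kernel u)) (at u)"
    by (simp add: fourier_squared_tent)
  then show ?thesis
    unfolding isCont_def by (simp add: tendsto_of_real_iff)
qed

text \<open>The kernel decays no faster than \<open>1 / (1 + u\<^sup>2)\<close>, so its reciprocal
  grows at most quadratically and is absorbed by an exponential. On \<open>{-2..2}\<close> a
  continuous positive function attains its minimum; beyond, \<open>sin u \<le> 1 \<le> u / 2\<close>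
  gives an explicit bound.\<close>

lemma tent_kernel_lower_bound:
  obtains c where "c > 0" "\<And>u. c \<le> (1 + u\<^sup>2) * tent_kernel u"
proof -
  have "\<exists>x\<in>{-2..2}. \<forall>y\<in>{-2..2}. (1 + x\<^sup>2) * tent_kernel x \<le> (1 + y\<^sup>2) * tent_kernel y"
    by (rule continuous_attains_inf)
       (auto intro!: continuous_intros continuous_at_imp_continuous_on isCont_tent_kernel)
  then obtain x where x: "\<And>y. \<bar>y\<bar> \<le> 2 \<Longrightarrow> (1 + x\<^sup>2) * tent_kernel x \<le> (1 + y\<^sup>2) * tent_kernel y"
    unfolding abs_le_iff by (metis atLeastAtMost_iff minus_le_iff)
  have large: "2 \<le> (1 + u\<^sup>2) * tent_kernel u" if "u \<ge> 2" for u
  proof -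
    have "1 / 2 * u \<le> u - sin u" using sin_le_one[of u] that by linarith
    then have "2 * u ^ 3 \<le> u\<^sup>2 * (4 * (u - sin u))"
      using that by (simp add: power2_eq_square power3_eq_cube mult_left_mono field_simps)
    then have "2 \<le> u\<^sup>2 * tent_kernel u"
      using that by (simp add: tent_kernel_def field_simps)
    then show ?thesis by (simp add: algebra_simps add_increasing)
  qed
  show thesis
  proof
    have "0 < 1 + x\<^sup>2" by (simp add: add_pos_nonneg)
    then show "0 < min 2 ((1 + x\<^sup>2) * tent_kernel x)" by simp
    show "min 2 ((1 + x\<^sup>2) * tent_kernel x) \<le> (1 + u\<^sup>2) * tent_kernel u" for u
      using x[of u] large[of "\<bar>u\<bar>"] by (cases "\<bar>u\<bar> \<le> 2") (auto simp: min_def)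
  qed
qed

text \<open>Near 0 the Fourier integral is at most the length 2 of the support; for
  \<open>v > 1\<close>, \<open>v - sin v \<le> 2 * v\<close> gives \<open>8 / v\<^sup>2\<close>. The
  constant 16 covers both cases.\<close>

lemma tent_kernel_le: "tent_kernel u \<le> 16 / (1 + u\<^sup>2)"
proof (cases "\<bar>u\<bar> \<le> 1")
  case True
  have "of_real (tent_kernel u) = (\<integral>y. of_real (squared_tent y) * cis (u * y) \<partial>lborel)"
    by (simp add: fourier_squared_tent)
  then have "tent_kernel u = norm (\<integral>y. of_real (squared_tent y) * cis (u * y) \<partial>lborel)"
    by (metis norm_of_real abs_of_nonneg tent_kernel_nonneg)
  also have "\<dots> \<le> (\<integral>y. indicator {-1..1::real} y \<partial>lborel)"
    by (intro Bochner_Integration.integral_norm_bound_integral integrable_squared_tent_mult[where B = 1])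
       (auto simp: norm_mult squared_tent_le)
  also have "\<dots> = 2" by simp
  also have "2 \<le> 16 / (1 + u\<^sup>2)"
  proof -
    have "u\<^sup>2 \<le> 1" using True by (simp add: abs_square_le_1)
    then show ?thesis by (simp add: field_simps add_pos_nonneg)
  qed
  finally show ?thesis .
next
  case False
  define v where "v = \<bar>u\<bar>"
  have v: "v > 1" using False by (simp add: v_def)
  have "v - sin v \<le> 2 * v" using sin_ge_minus_one[of v] v by linarith
  then have "tent_kernel v \<le> 4 * (2 * v) / v ^ 3"
    using v by (auto simp: tent_kernel_def intro!: divide_right_mono)
  also have "\<dots> = 8 / v\<^sup>2" using v by (simp add: power2_eq_square power3_eq_cube)
  also have "\<dots> \<le> 16 / (1 + v\<^sup>2)" using v power_mono[of 1 v 2] by (simp add: field_simps add_pos_nonneg)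
  finally show ?thesis by (simp add: v_def)
qed

lemma tent_kernel_le_16: "tent_kernel u \<le> 16"
proof -
  have "16 / (1 + u\<^sup>2) \<le> 16 / 1"
    by (intro divide_left_mono) (auto simp: add_pos_nonneg)
  then show ?thesis using tent_kernel_le[of u] by simp
qed

lemma integrable_tent_kernel: "integrable lborel tent_kernel"
proof (rule Bochner_Integration.integrable_bound)
  show "integrable lborel (\<lambda>u::real. 16 * inverse (1 + u\<^sup>2))"
    using integrable_inverse_1_plus_square by (simp add: set_integrable_def)
qed (auto intro!: tent_kernel_le simp: field_simps order_trans[OF tent_kernel_le] simp flip: divide_inverse)

lemma integral_tent_kernel_pos: "0 < (\<integral>u. tent_kernel u \<partial>lborel)"
proof -
  have "(\<integral>u. tent_kernel u \<partial>lborel) \<noteq> 0"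
    by (subst integral_nonneg_eq_0_iff_AE[OF integrable_tent_kernel])
       (auto simp: eventually_False ae_filter_eq_bot_iff)
  moreover have "0 \<le> (\<integral>u. tent_kernel u \<partial>lborel)" by simp
  ultimately show ?thesis by linarith
qed

section \<open>Oscillatory integrals of poles and of continuous functions\<close>

text \<open>
  Translating the variable by \<open>pi / t\<close> changes the sign of \<open>cis (t * y)\<close>, so the integral is
  bounded by the \<open>L\<^sup>1\<close> distance between \<open>f\<close> and its translate.
\<close>

lemma riemann_lebesgue:
  fixes f :: "real \<Rightarrow> complex"
  assumes f: "continuous_on UNIV f" and supp: "\<And>y. \<bar>y\<bar> > 1 \<Longrightarrow> f y = 0"
  shows "((\<lambda>t. \<integral>y. f y * cis (t * y) \<partial>lborel) \<longlongrightarrow> 0) at_top"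
proof -
  have [measurable]: "f \<in> borel_measurable borel" using f by (rule borel_measurable_continuous_onI)
  have "bounded (f ` {-1..1})"
    by (intro compact_imp_bounded compact_continuous_image continuous_on_subset[OF f]) auto
  then obtain B where B: "B > 0" "\<And>y. \<bar>y\<bar> \<le> 1 \<Longrightarrow> norm (f y) \<le> B"
    unfolding bounded_pos by (auto simp: abs_le_iff)
  have fB: "norm (f y) \<le> B * indicator {-1..1} y" for y
    using B(1) B(2)[of y] supp[of y] by (cases "\<bar>y\<bar> \<le> 1") (auto simp: indicator_def)
  have fB': "norm (f y) \<le> B" for y
    using B(1) B(2)[of y] supp[of y] by (cases "\<bar>y\<bar> \<le> 1") auto
  have int_f: "integrable lborel f"
    by (rule Bochner_Integration.integrable_bound[of _ "\<lambda>y. B * indicator {-1..1::real} y"])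
       (auto intro!: order_trans[OF fB] simp: B less_imp_le)
  have int_fc: "integrable lborel (\<lambda>y. f y * cis (t * y))" for t
    by (rule Bochner_Integration.integrable_bound[OF int_f]) (auto simp: norm_mult)
  have bound: "norm (\<integral>y. f y * cis (t * y) \<partial>lborel) \<le> (\<integral>y. norm (f y - f (pi / t + y)) \<partial>lborel)"
    if "t > 0" for t
  proof -
    have shift: "(\<integral>y. f y * cis (t * y) \<partial>lborel) = (\<integral>y. - (f (pi / t + y) * cis (t * y)) \<partial>lborel)"
      by (subst lborel_integral_real_affine[of 1 _ "pi / t"])
         (use that in \<open>auto simp: distrib_left cis_mult[symmetric]\<close>)
    have int2: "integrable lborel (\<lambda>y. f (pi / t + y) * cis (t * y))"
      by (rule Bochner_Integration.integrable_bound[OF lborel_integrable_real_affine[OF int_f, of 1 "pi / t"]])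
         (auto simp: norm_mult)
    have "2 * (\<integral>y. f y * cis (t * y) \<partial>lborel) =
          (\<integral>y. f y * cis (t * y) \<partial>lborel) + (\<integral>y. - (f (pi / t + y) * cis (t * y)) \<partial>lborel)"
      using shift by simp
    also have "\<dots> = (\<integral>y. f y * cis (t * y) + - (f (pi / t + y) * cis (t * y)) \<partial>lborel)"
      by (intro Bochner_Integration.integral_add[symmetric] int_fc integrable_minus int2)
    also have "\<dots> = (\<integral>y. (f y - f (pi / t + y)) * cis (t * y) \<partial>lborel)"
      by (simp add: algebra_simps)
    also have "norm \<dots> \<le> (\<integral>y. norm ((f y - f (pi / t + y)) * cis (t * y)) \<partial>lborel)"
      by (rule integral_norm_bound)
    finally have "2 * norm (\<integral>y. f y * cis (t * y) \<partial>lborel) \<le> (\<integral>y. norm (f y - f (pi / t + y)) \<partial>lborel)"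
      by (simp add: norm_mult)
    then show ?thesis
      using norm_ge_zero[of "\<integral>y. f y * cis (t * y) \<partial>lborel"] by linarith
  qed
  have lim: "((\<lambda>t. \<integral>y. norm (f y - f (pi / t + y)) \<partial>lborel) \<longlongrightarrow> (\<integral>y. 0 \<partial>(lborel :: real measure))) at_top"
  proof (rule integral_dominated_convergence_at_top)
    show "AE y in lborel. ((\<lambda>t. norm (f y - f (pi / t + y))) \<longlongrightarrow> 0) at_top"
    proof (rule AE_I2)
      fix y :: real
      have "((\<lambda>t. pi / t + y) \<longlongrightarrow> y) at_top" by real_asymp
      then have "((\<lambda>t. f (pi / t + y)) \<longlongrightarrow> f y) at_top"
        using f by (intro isCont_tendsto_compose[of y f]) (auto simp: continuous_on_eq_continuous_at)
      then show "((\<lambda>t. norm (f y - f (pi / t + y))) \<longlongrightarrow> 0) at_top"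
        by (intro tendsto_norm_zero) (auto intro: tendsto_eq_intros)
    qed
    \<comment> \<open>For \<open>t \<ge> 1\<close> the shift \<open>pi / t\<close> is below 4, so
      \<open>f\<close> and its translate both vanish outside \<open>{-5..5}\<close>.\<close>
    show "\<forall>\<^sub>F t in at_top. AE y in lborel. norm (norm (f y - f (pi / t + y))) \<le> 2 * B * indicator {-5..5} y"
      using eventually_ge_at_top[of 1]
    proof eventually_elim
      case (elim t)
      have "0 < pi / t" "pi / t \<le> 4" using elim pi_less_4 by (auto simp: field_simps)
      then have "norm (f y - f (pi / t + y)) \<le> 2 * B * indicator {-5..5} y" for y
      proof (cases "y \<in> {-5..5}")
        case True
        then show ?thesis
          using fB'[of y] fB'[of "pi / t + y"] norm_triangle_ineq4[of "f y" "f (pi / t + y)"] by simp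
      next
        case False
        then show ?thesis
          using supp[of y] supp[of "pi / t + y"] \<open>0 < pi / t\<close> \<open>pi / t \<le> 4\<close> by auto
      qed
      then show ?case by simp
    qed
  qed auto
  have lim0: "((\<lambda>t. \<integral>y. norm (f y - f (pi / t + y)) \<partial>lborel) \<longlongrightarrow> 0) at_top"
    using lim by simp
  show ?thesis
    by (rule Lim_null_comparison[OF eventually_mono[OF eventually_gt_at_top[of 0]] lim0]) (use bound in auto)
qed

section \<open>Exchange of integrals and Laplace transforms of powers\<close>

text \<open>Fubini: the integrand has norm \<open>norm (w x) * squared_tent y\<close>, a product of
  integrable functions. The measure is kept general because the identity is applied both to the
  counting measure (the series) and to Lebesgue measure (the poles).\<close>

lemma tent_kernel_transform:
  fixes w :: "'a \<Rightarrow> complex" and \<tau> :: "'a \<Rightarrow> real"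
  assumes "sigma_finite_measure M" and w: "integrable M w" and \<tau> [measurable]: "\<tau> \<in> borel_measurable M"
  shows "(\<integral>y. of_real (squared_tent y) * (cis (T * (y + \<xi>)) * (\<integral>x. w x * cis (- ((y + \<xi>) * \<tau> x)) \<partial>M)) \<partial>lborel)
    = (\<integral>x. w x * (of_real (tent_kernel (T - \<tau> x)) * cis (\<xi> * (T - \<tau> x))) \<partial>M)"
proof -
  interpret M: sigma_finite_measure M by fact
  interpret P: pair_sigma_finite M "lborel :: real measure" ..
  have [measurable]: "w \<in> borel_measurable M" using w by simp
  \<comment> \<open>The phases are grouped so that the integral over \<open>y\<close> is the Fourier
    transform of the squared tent at \<open>T - \<tau> x\<close>.\<close>
  define f where "f = (\<lambda>x y. w x * (cis (\<xi> * (T - \<tau> x)) * (of_real (squared_tent y) * cis ((T - \<tau> x) * y))))"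
  have [measurable]: "case_prod f \<in> borel_measurable (M \<Otimes>\<^sub>M lborel)"
    unfolding f_def by measurable
  have int_y: "integrable lborel (\<lambda>y. of_real (squared_tent y) * cis (u * y))" for u
    by (rule integrable_squared_tent_mult[where B = 1]) auto
  have norm_f: "norm (f x y) = norm (w x) * squared_tent y" for x y
    by (simp add: f_def norm_mult)
  have "integrable (M \<Otimes>\<^sub>M lborel) (case_prod f)"
  proof (rule P.Fubini_integrable)
    show "integrable M (\<lambda>x. \<integral>y. norm (case_prod f (x, y)) \<partial>lborel)"
      using w by (simp add: norm_f)
    show "AE x in M. integrable lborel (\<lambda>y. case_prod f (x, y))"
      unfolding f_def by (auto intro!: integrable_mult_right int_y)
  qed measurable
  then have "(\<integral>y. (\<integral>x. f x y \<partial>M) \<partial>lborel) = (\<integral>x. (\<integral>y. f x y \<partial>lborel) \<partial>M)"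
    by (rule P.Fubini_integral)
  moreover have "(\<integral>y. f x y \<partial>lborel) = w x * (of_real (tent_kernel (T - \<tau> x)) * cis (\<xi> * (T - \<tau> x)))" for x
    by (simp add: f_def fourier_squared_tent)
  moreover have "(\<integral>x. f x y \<partial>M) = of_real (squared_tent y) * (cis (T * (y + \<xi>)) * (\<integral>x. w x * cis (- ((y + \<xi>) * \<tau> x)) \<partial>M))" for y
  proof -
    have "f x y = (of_real (squared_tent y) * cis (T * (y + \<xi>))) * (w x * cis (- ((y + \<xi>) * \<tau> x)))" for x
    proof -
      have "cis (\<xi> * (T - \<tau> x)) * cis ((T - \<tau> x) * y) = cis (T * (y + \<xi>)) * cis (- ((y + \<xi>) * \<tau> x))"
        by (simp add: cis_mult algebra_simps)
      then show ?thesis by (simp add: f_def mult_ac)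
    qed
    then show ?thesis by (simp add: mult.assoc)
  qed
  ultimately show ?thesis by simp
qed

text \<open>The integrals over \<open>{0..real n}\<close> are given by the compact case and converge
  by dominated convergence.\<close>

lemma integral_FTC_atLeast:
  fixes f F :: "real \<Rightarrow> complex"
  assumes F: "\<And>x. (F has_vector_derivative f x) (at x)" and f: "continuous_on UNIV f"
    and int: "integrable lborel (\<lambda>x. indicator {0..} x *\<^sub>R f x)"
    and L: "(\<lambda>n::nat. F (real n)) \<longlonglongrightarrow> L"
  shows "(\<integral>x. indicator {0..} x *\<^sub>R f x \<partial>lborel) = L - F 0"
proof (rule LIMSEQ_unique)
  show "(\<lambda>n. \<integral>x. indicator {0..real n} x *\<^sub>R f x \<partial>lborel) \<longlonglongrightarrow> (\<integral>x. indicator {0..} x *\<^sub>R f x \<partial>lborel)"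
  proof (rule integral_dominated_convergence)
    have [measurable]: "f \<in> borel_measurable borel" using f by (rule borel_measurable_continuous_onI)
    show "(\<lambda>x. indicator {0..} x *\<^sub>R f x) \<in> borel_measurable lborel"
      "(\<lambda>x. indicator {0..real n} x *\<^sub>R f x) \<in> borel_measurable lborel" for n by auto
    show "integrable lborel (\<lambda>x. norm (indicator {0..} x *\<^sub>R f x))" using int by (rule integrable_norm)
    show "AE x in lborel. (\<lambda>n. indicator {0..real n} x *\<^sub>R f x) \<longlonglongrightarrow> indicator {0..} x *\<^sub>R f x"
    proof (rule AE_I2)
      fix x :: real
      obtain N where "x \<le> real N" using real_arch_simple by blast
      then have "\<forall>\<^sub>F n in sequentially. indicator {0..real n} x *\<^sub>R f x = indicator {0..} x *\<^sub>R f x"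
        by (intro eventually_sequentiallyI[of N]) (auto simp: indicator_def)
      then show "(\<lambda>n. indicator {0..real n} x *\<^sub>R f x) \<longlonglongrightarrow> indicator {0..} x *\<^sub>R f x"
        by (rule tendsto_eventually)
    qed
  qed (auto simp: indicator_def)
  have "(\<integral>x. indicator {0..real n} x *\<^sub>R f x \<partial>lborel) = F (real n) - F 0" for n
    by (rule integral_FTC_atLeastAtMost)
       (auto intro: has_vector_derivative_at_within F continuous_on_subset[OF f])
  then show "(\<lambda>n. \<integral>x. indicator {0..real n} x *\<^sub>R f x \<partial>lborel) \<longlonglongrightarrow> L - F 0"
    by (simp add: L tendsto_diff)
qed

text \<open>Up to a constant, the integrand is the Erlang density, whose total mass is 1.\<close>

lemma integrable_power_exp:
  assumes "0 < l"
  shows "integrable lborel (\<lambda>t::real. indicator {0..} t * (t ^ k * exp (- l * t)))"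
proof -
  have "emeasure (density lborel (erlang_density k l)) UNIV = 1"
    using prob_space.emeasure_space_1[OF prob_space_erlang_density[OF assms]] by simp
  then have "(\<integral>\<^sup>+x. ennreal (erlang_density k l x) \<partial>lborel) = 1"
    by (simp add: emeasure_density)
  then have "integrable lborel (erlang_density k l)"
    using assms by (intro integrableI_nonneg) auto
  then have "integrable lborel (\<lambda>t. fact k / l ^ Suc k * erlang_density k l t)" by simp
  also have "(\<lambda>t. fact k / l ^ Suc k * erlang_density k l t) = (\<lambda>t. indicator {0..} t * (t ^ k * exp (- l * t)))"
    using assms by (auto simp: erlang_density_def indicator_def fun_eq_iff)
  finally show ?thesis .
qed

lemma integrable_power_cexp:
  assumes "0 < Re z"
  shows "integrable lborel (\<lambda>t. indicator {0..} t *\<^sub>R (of_real t ^ k * exp (- z * of_real t)))"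
  by (rule Bochner_Integration.integrable_bound[OF integrable_power_exp[OF assms, of k]])
     (auto simp: norm_mult norm_power indicator_def)

lemma laplace_power:
  assumes z: "0 < Re z"
  shows "(\<integral>t. indicator {0..} t *\<^sub>R (of_real t ^ k * exp (- z * of_real t)) \<partial>lborel) = fact k / z ^ Suc k"
proof (induction k)
  have lim: "(\<lambda>n. of_real (real n) ^ k * exp (- z * of_real (real n))) \<longlonglongrightarrow> 0" for k
  proof (rule tendsto_norm_zero_cancel)
    have "(\<lambda>n. real n ^ k * exp (- Re z * real n)) \<longlonglongrightarrow> 0"
      using z by real_asymp
    then show "(\<lambda>n. norm (of_real (real n) ^ k * exp (- z * of_real (real n)))) \<longlonglongrightarrow> 0"
      by (simp add: norm_mult norm_power)
  qed
  have z0: "z \<noteq> 0" using z by auto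
  {
    case 0
    have "(\<integral>t. indicator {0..} t *\<^sub>R exp (- z * of_real t) \<partial>lborel) = 0 - (- exp (- z * of_real 0) / z)"
    proof (rule integral_FTC_atLeast)
      show "((\<lambda>t. - exp (- z * of_real t) / z) has_vector_derivative exp (- z * of_real x)) (at x)" for x
        by (rule has_vector_derivative_real_field[of "\<lambda>t. - exp (- z * t) / z"])
           (use z0 in \<open>auto intro!: derivative_eq_intros\<close>)
      show "(\<lambda>n. - exp (- z * of_real (real n)) / z) \<longlonglongrightarrow> 0"
        using tendsto_divide[OF tendsto_minus[OF lim[of 0]] tendsto_const[of z]] z0 by simp
    qed (use integrable_power_cexp[OF z, of 0] in \<open>auto intro!: continuous_intros\<close>)
    then show ?case by simp
  next
    case (Suc k)
    let ?I = "\<lambda>k t. indicator {0..} t *\<^sub>R (of_real t ^ k * exp (- z * of_real t))"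
    \<comment> \<open>\<open>?f\<close> is the derivative of
      \<open>t ^ Suc k * exp (- z * t)\<close>, which vanishes at 0 and at infinity; integrating it
      gives the recursion between consecutive exponents.\<close>
    let ?f = "\<lambda>t. of_nat (Suc k) * (of_real t ^ k * exp (- z * of_real t)) - z * (of_real t ^ Suc k * exp (- z * of_real t))"
    have eq: "indicator {0..} t *\<^sub>R ?f t = of_nat (Suc k) * ?I k t - z * ?I (Suc k) t" for t :: real
      by (simp add: indicator_def)
    have "(\<integral>t. indicator {0..} t *\<^sub>R ?f t \<partial>lborel) = 0 - of_real 0 ^ Suc k * exp (- z * of_real 0)"
    proof (rule integral_FTC_atLeast)
      show "((\<lambda>t. of_real t ^ Suc k * exp (- z * of_real t)) has_vector_derivative ?f x) (at x)" for x
        by (rule has_vector_derivative_real_field[of "\<lambda>t. t ^ Suc k * exp (- z * t)"])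
           (auto intro!: derivative_eq_intros simp: algebra_simps,
            metis neq0_conv One_nat_def mult.commute power_minus_mult)
      show "integrable lborel (\<lambda>t. indicator {0..} t *\<^sub>R ?f t)"
        unfolding eq by (intro Bochner_Integration.integrable_diff integrable_mult_right integrable_power_cexp z)
    qed (use lim[of "Suc k"] in \<open>auto intro!: continuous_intros\<close>)
    moreover have "(\<integral>t. indicator {0..} t *\<^sub>R ?f t \<partial>lborel) =
        (\<integral>t. of_nat (Suc k) * ?I k t \<partial>lborel) - (\<integral>t. z * ?I (Suc k) t \<partial>lborel)"
      unfolding eq by (intro Bochner_Integration.integral_diff integrable_mult_right integrable_power_cexp z)
    ultimately have "of_nat (Suc k) * (\<integral>t. ?I k t \<partial>lborel) - z * (\<integral>t. ?I (Suc k) t \<partial>lborel) = 0"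
      by (simp only: integral_mult_right_zero) simp
    then show ?case unfolding Suc.IH using z0 by (simp add: field_simps)
  }
qed

text \<open>A single term of the exponential series is at most the whole series.\<close>

lemma power_exp_le_fact:
  fixes x :: real assumes "0 \<le> x" shows "x ^ j * exp (- x) \<le> fact j"
proof -
  have "(\<Sum>i\<in>{j}. x ^ i /\<^sub>R fact i) \<le> (\<Sum>i. x ^ i /\<^sub>R fact i)"
    using assms by (intro sum_le_suminf summable_exp_generic) auto
  then have "x ^ j / fact j \<le> exp x" by (simp add: exp_def field_simps)
  then show ?thesis by (simp add: exp_minus field_simps)
qed

section \<open>Contributions of a pole and of the continuous remainder\<close>

text \<open>The pole at height \<open>v\<close> is the Laplace transform of
  \<open>t ^ j / fact j\<close> at \<open>Complex \<epsilon> v\<close>. Fubini then applies with the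
  damped weight \<open>t ^ j * exp (- \<epsilon> * t) / fact j\<close> on the half-line.\<close>

lemma tent_transform_pole:
  assumes "0 < \<epsilon>"
  shows "(\<integral>y. of_real (squared_tent y) * (cis (T * (y + \<xi>)) * (1 / Complex \<epsilon> (y + \<xi>) ^ Suc j)) \<partial>lborel)
    = (\<integral>t. indicator {0..} t *\<^sub>R (of_real (t ^ j * exp (- \<epsilon> * t) / fact j * tent_kernel (T - t)) * cis (\<xi> * (T - t))) \<partial>lborel)"
proof -
  define w where "w t = indicator {0..} t *\<^sub>R (complex_of_real t ^ j * exp (- of_real \<epsilon> * of_real t)) / fact j" for t :: real
  have "integrable lborel w"
    unfolding w_def using integrable_power_cexp[of "of_real \<epsilon>" j] assms by simp
  then have *: "(\<integral>y. of_real (squared_tent y) * (cis (T * (y + \<xi>)) * (\<integral>t. w t * cis (- ((y + \<xi>) * t)) \<partial>lborel)) \<partial>lborel)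
    = (\<integral>t. w t * (of_real (tent_kernel (T - t)) * cis (\<xi> * (T - t))) \<partial>lborel)"
    by (intro tent_kernel_transform lborel.sigma_finite_measure_axioms) auto
  have "(\<integral>t. w t * cis (- (v * t)) \<partial>lborel) = 1 / Complex \<epsilon> v ^ Suc j" for v
  proof -
    have "w t * cis (- (v * t)) = indicator {0..} t *\<^sub>R (complex_of_real t ^ j * exp (- Complex \<epsilon> v * of_real t)) / fact j" for t
      by (simp add: w_def cis_conv_exp Complex_eq exp_add[symmetric] algebra_simps indicator_def)
    then show ?thesis using laplace_power[of "Complex \<epsilon> v" j] assms by simp
  qed
  moreover have "w t * (of_real (tent_kernel (T - t)) * cis (\<xi> * (T - t))) =
     indicator {0..} t *\<^sub>R (of_real (t ^ j * exp (- \<epsilon> * t) / fact j * tent_kernel (T - t)) * cis (\<xi> * (T - t)))" for t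
    by (simp add: w_def indicator_def exp_of_real[symmetric])
  ultimately show ?thesis using * by simp
qed

text \<open>After the substitution \<open>t = T - u\<close> and division by \<open>T ^ j\<close>,
  the weight becomes \<open>x ^ j * exp (- x) / fact j\<close> with \<open>x = (T - u) / T\<close>.
  It is at most 1 for \<open>x \<ge> 0\<close> and tends to \<open>exp (- 1) / fact j\<close> as
  \<open>x\<close> tends to 1, so the integrable kernel itself dominates.\<close>

lemma tent_transform_pole_asymptotics:
  "((\<lambda>T. (\<integral>y. of_real (squared_tent y) * (cis (T * (y + \<xi>)) * (1 / Complex (1 / T) (y + \<xi>) ^ Suc j)) \<partial>lborel) / of_real T ^ j)
     \<longlongrightarrow> of_real (exp (- 1) / fact j) * (\<integral>u. of_real (tent_kernel u) * cis (\<xi> * u) \<partial>lborel)) at_top"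
proof -
  define G where "G T u = indicator {..T} u *\<^sub>R (of_real (((T - u) / T) ^ j * exp (- ((T - u) / T)) / fact j) * (of_real (tent_kernel u) * cis (\<xi> * u)))" for T u
  define L where "L u = of_real (exp (- 1) / fact j) * (of_real (tent_kernel u) * cis (\<xi> * u))" for u
  have "((\<lambda>T. \<integral>u. G T u \<partial>lborel) \<longlongrightarrow> (\<integral>u. L u \<partial>lborel)) at_top"
  proof (rule integral_dominated_convergence_at_top)
    show "AE u in lborel. ((\<lambda>T. G T u) \<longlongrightarrow> L u) at_top"
    proof (rule AE_I2)
      fix u :: real
      have "((\<lambda>T. ((T - u) / T) ^ j * exp (- ((T - u) / T)) / fact j) \<longlongrightarrow> 1 ^ j * exp (- 1) / fact j) at_top"
        by (intro tendsto_intros) (real_asymp, real_asymp, simp)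
      then have "((\<lambda>T. of_real (((T - u) / T) ^ j * exp (- ((T - u) / T)) / fact j) * (of_real (tent_kernel u) * cis (\<xi> * u))) \<longlongrightarrow> L u) at_top"
        unfolding L_def by (intro tendsto_mult[OF tendsto_of_real tendsto_const]) simp
      moreover have "\<forall>\<^sub>F T in at_top. of_real (((T - u) / T) ^ j * exp (- ((T - u) / T)) / fact j) * (of_real (tent_kernel u) * cis (\<xi> * u)) = G T u"
        using eventually_ge_at_top[of u] by eventually_elim (simp add: G_def)
      ultimately show "((\<lambda>T. G T u) \<longlongrightarrow> L u) at_top"
        by (rule Lim_transform_eventually)
    qed
    show "\<forall>\<^sub>F T in at_top. AE u in lborel. norm (G T u) \<le> tent_kernel u"
      using eventually_gt_at_top[of 0]
    proof eventually_elim
      case (elim T)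
      have "norm (G T u) \<le> tent_kernel u" for u
      proof (cases "u \<le> T")
        case True
        define x where "x = (T - u) / T"
        have x: "x \<ge> 0" using True elim by (simp add: x_def)
        have "x ^ j * exp (- x) / fact j * tent_kernel u \<le> 1 * tent_kernel u"
          using power_exp_le_fact[OF x, of j] by (intro mult_right_mono) auto
        then show ?thesis using True x by (simp add: G_def norm_mult x_def[symmetric] norm_divide norm_power)
      qed (simp add: G_def)
      then show ?case by simp
    qed
  qed (auto simp: G_def[abs_def] L_def[abs_def] integrable_tent_kernel)
  then have "((\<lambda>T. \<integral>u. G T u \<partial>lborel) \<longlongrightarrow> of_real (exp (- 1) / fact j) * (\<integral>u. of_real (tent_kernel u) * cis (\<xi> * u) \<partial>lborel)) at_top"
    by (simp add: L_def)
  moreover have "\<forall>\<^sub>F T in at_top. (\<integral>u. G T u \<partial>lborel) =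
     (\<integral>y. of_real (squared_tent y) * (cis (T * (y + \<xi>)) * (1 / Complex (1 / T) (y + \<xi>) ^ Suc j)) \<partial>lborel) / of_real T ^ j"
    using eventually_gt_at_top[of 0]
  proof eventually_elim
    case (elim T)
    have "(\<integral>y. of_real (squared_tent y) * (cis (T * (y + \<xi>)) * (1 / Complex (1 / T) (y + \<xi>) ^ Suc j)) \<partial>lborel) / of_real T ^ j
      = (\<integral>t. indicator {0..} t *\<^sub>R (of_real (t ^ j * exp (- (1 / T) * t) / fact j * tent_kernel (T - t)) * cis (\<xi> * (T - t))) \<partial>lborel) / of_real T ^ j"
      using elim by (subst tent_transform_pole) auto
    \<comment> \<open>The reflection \<open>t = T - u\<close> moves the kernel back to the
      origin.\<close>
    also have "\<dots> = (\<integral>u. indicator {0..} (T - u) *\<^sub>R (of_real ((T - u) ^ j * exp (- (1 / T) * (T - u)) / fact j * tent_kernel u) * cis (\<xi> * u)) \<partial>lborel) / of_real T ^ j"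
      by (subst lborel_integral_real_affine[of "-1" _ T]) auto
    also have "\<dots> = (\<integral>u. indicator {0..} (T - u) *\<^sub>R (of_real ((T - u) ^ j * exp (- (1 / T) * (T - u)) / fact j * tent_kernel u) * cis (\<xi> * u)) / of_real T ^ j \<partial>lborel)"
      by simp
    also have "\<dots> = (\<integral>u. G T u \<partial>lborel)"
      by (intro Bochner_Integration.integral_cong) (auto simp: G_def indicator_def power_divide mult_ac)
    finally show ?case ..
  qed
  ultimately show ?thesis by (rule Lim_transform_eventually)
qed

text \<open>\<open>H\<close> on the line of abscissa \<open>1 / T\<close> is compared with its
  boundary values: the difference vanishes by dominated convergence, the boundary integral by
  Riemann-Lebesgue.\<close>

lemma tent_transform_continuous_vanishes:
  fixes H :: "complex \<Rightarrow> complex"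
  assumes H: "continuous_on {z. 0 \<le> Re z} H"
  shows "((\<lambda>T. \<integral>y. of_real (squared_tent y) * (cis (T * (y + \<xi>)) * H (Complex (1 / T) (y + \<xi>))) \<partial>lborel) \<longlongrightarrow> 0) at_top"
proof -
  have cont_H: "continuous_on UNIV (\<lambda>y. H (Complex \<epsilon> (y + \<xi>)))" if "\<epsilon> \<ge> 0" for \<epsilon>
    by (rule continuous_on_compose2[OF H]) (use that in \<open>auto intro!: continuous_intros simp: Complex_eq\<close>)
  have meas [measurable]: "(\<lambda>y. H (Complex \<epsilon> (y + \<xi>))) \<in> borel_measurable borel" if "\<epsilon> \<ge> 0" for \<epsilon>
    using cont_H[OF that] by (rule borel_measurable_continuous_onI)
  have cont: "continuous_on S (\<lambda>(e, y). Complex e y)" for S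
    by (auto simp: case_prod_unfold Complex_eq intro!: continuous_intros)
  have "bounded (H ` (\<lambda>(e, y). Complex e y) ` ({0..1} \<times> {\<xi> - 1..\<xi> + 1}))"
    by (intro compact_imp_bounded compact_continuous_image continuous_on_subset[OF H] cont
        compact_Times compact_Icc) auto
  then obtain B where "\<forall>e\<in>{0..1}. \<forall>y\<in>{\<xi> - 1..\<xi> + 1}. norm (H (Complex e y)) \<le> B"
    by (auto simp: bounded_iff)
  then have B: "norm (H (Complex e (y + \<xi>))) \<le> B" if "0 \<le> e" "e \<le> 1" "\<bar>y\<bar> \<le> 1" for e y
    using that by (auto simp: abs_le_iff)
  let ?D = "\<lambda>T y. of_real (squared_tent y) * (cis (T * (y + \<xi>)) * (H (Complex (1 / T) (y + \<xi>)) - H (Complex 0 (y + \<xi>))))"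
  \<comment> \<open>Using \<open>max 1 T\<close> keeps the abscissa in \<open>{0..1}\<close> for
    every \<open>T\<close>, so measurability and the bound \<open>B\<close> hold without
    restriction.\<close>
  have "((\<lambda>T. \<integral>y. ?D (max 1 T) y \<partial>lborel) \<longlongrightarrow> (\<integral>y. 0 \<partial>(lborel :: real measure))) at_top"
  proof (rule integral_dominated_convergence_at_top)
    show "AE y in lborel. ((\<lambda>T. ?D (max 1 T) y) \<longlongrightarrow> 0) at_top"
    proof (rule AE_I2)
      fix y :: real
      have "((\<lambda>T. Complex (1 / max 1 T) (y + \<xi>)) \<longlongrightarrow> Complex 0 (y + \<xi>)) at_top"
        unfolding Complex_eq by (intro tendsto_intros tendsto_of_real) real_asymp
      then have "((\<lambda>T. H (Complex (1 / max 1 T) (y + \<xi>))) \<longlongrightarrow> H (Complex 0 (y + \<xi>))) at_top"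
        by (rule continuous_on_tendsto_compose[OF H]) (auto simp: le_max_iff_disj)
      then have "((\<lambda>T. norm (H (Complex (1 / max 1 T) (y + \<xi>)) - H (Complex 0 (y + \<xi>)))) \<longlongrightarrow> 0) at_top"
        by (intro tendsto_norm_zero) (simp add: LIM_zero)
      then have "((\<lambda>T. squared_tent y * norm (H (Complex (1 / max 1 T) (y + \<xi>)) - H (Complex 0 (y + \<xi>)))) \<longlongrightarrow> 0) at_top"
        by (rule tendsto_mult_right_zero)
      then show "((\<lambda>T. ?D (max 1 T) y) \<longlongrightarrow> 0) at_top"
        by (intro tendsto_norm_zero_cancel[where f = "\<lambda>T. ?D (max 1 T) y"]) (simp add: norm_mult)
    qed
    show "\<forall>\<^sub>F T in at_top. AE y in lborel. norm (?D (max 1 T) y) \<le> 2 * B * indicator {-1..1} y"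
    proof (intro always_eventually allI AE_I2)
      fix T y :: real
      show "norm (?D (max 1 T) y) \<le> 2 * B * indicator {-1..1} y"
      proof (cases "\<bar>y\<bar> \<le> 1")
        case True
        have "norm (H (Complex (1 / max 1 T) (y + \<xi>)) - H (Complex 0 (y + \<xi>))) \<le> 2 * B"
          using B[of "1 / max 1 T" y] B[of 0 y] True norm_triangle_ineq4
          by (smt (verit, best) divide_le_eq_1 divide_nonneg_nonneg)
        then have "squared_tent y * norm (H (Complex (1 / max 1 T) (y + \<xi>)) - H (Complex 0 (y + \<xi>))) \<le> 1 * (2 * B)"
          by (intro mult_mono squared_tent_le_1) auto
        then show ?thesis using True by (simp add: norm_mult abs_le_iff)
      qed (auto simp: squared_tent_eq_0 indicator_def)
    qed
  qed (auto intro!: borel_measurable_times borel_measurable_diff meas)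
  moreover have "((\<lambda>T. cis (T * \<xi>) * (\<integral>y. of_real (squared_tent y) * H (Complex 0 (y + \<xi>)) * cis (T * y) \<partial>lborel)) \<longlongrightarrow> 0) at_top"
  proof (rule tendsto_norm_zero_cancel)
    have "((\<lambda>T. \<integral>y. of_real (squared_tent y) * H (Complex 0 (y + \<xi>)) * cis (T * y) \<partial>lborel) \<longlongrightarrow> 0) at_top"
      by (rule riemann_lebesgue) (auto intro!: continuous_intros cont_H simp: squared_tent_eq_0)
    then show "((\<lambda>T. norm (cis (T * \<xi>) * (\<integral>y. of_real (squared_tent y) * H (Complex 0 (y + \<xi>)) * cis (T * y) \<partial>lborel))) \<longlongrightarrow> 0) at_top"
      by (simp add: norm_mult tendsto_norm_zero)
  qed
  ultimately have "((\<lambda>T. (\<integral>y. ?D (max 1 T) y \<partial>lborel) +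
      cis (T * \<xi>) * (\<integral>y. of_real (squared_tent y) * H (Complex 0 (y + \<xi>)) * cis (T * y) \<partial>lborel)) \<longlongrightarrow> 0) at_top"
    using tendsto_add by fastforce
  moreover have "\<forall>\<^sub>F T in at_top. (\<integral>y. ?D (max 1 T) y \<partial>lborel) +
      cis (T * \<xi>) * (\<integral>y. of_real (squared_tent y) * H (Complex 0 (y + \<xi>)) * cis (T * y) \<partial>lborel) =
      (\<integral>y. of_real (squared_tent y) * (cis (T * (y + \<xi>)) * H (Complex (1 / T) (y + \<xi>))) \<partial>lborel)"
    using eventually_ge_at_top[of 1]
  proof eventually_elim
    case (elim T)
    have int: "integrable lborel (\<lambda>y. of_real (squared_tent y) * (cis (T * (y + \<xi>)) * H (Complex e (y + \<xi>))))"
      if "0 \<le> e" "e \<le> 1" for e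
      by (rule integrable_squared_tent_mult[where B = B])
         (use that B in \<open>auto simp: norm_mult intro!: borel_measurable_times meas\<close>)
    have "cis (T * \<xi>) * (\<integral>y. of_real (squared_tent y) * H (Complex 0 (y + \<xi>)) * cis (T * y) \<partial>lborel)
       = (\<integral>y. cis (T * \<xi>) * (of_real (squared_tent y) * H (Complex 0 (y + \<xi>)) * cis (T * y)) \<partial>lborel)"
      by simp
    also have "\<dots> = (\<integral>y. of_real (squared_tent y) * (cis (T * (y + \<xi>)) * H (Complex 0 (y + \<xi>))) \<partial>lborel)"
      by (simp add: distrib_left cis_mult[symmetric] mult_ac)
    finally have 1: "cis (T * \<xi>) * (\<integral>y. of_real (squared_tent y) * H (Complex 0 (y + \<xi>)) * cis (T * y) \<partial>lborel) = \<dots>" .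
    have "(\<integral>y. ?D T y \<partial>lborel) = (\<integral>y. of_real (squared_tent y) * (cis (T * (y + \<xi>)) * H (Complex (1 / T) (y + \<xi>))) \<partial>lborel)
        - (\<integral>y. of_real (squared_tent y) * (cis (T * (y + \<xi>)) * H (Complex 0 (y + \<xi>))) \<partial>lborel)"
      unfolding right_diff_distrib by (intro Bochner_Integration.integral_diff int) (use elim in auto)
    with 1 elim show ?case by (simp add: max_def)
  qed
  ultimately show ?thesis by (rule Lim_transform_eventually)
qed

section \<open>Weak convergence of the weighted exponents\<close>

text \<open>The coefficient \<open>d i\<close> belongs to the pole part of order \<open>m - i\<close>, so \<open>d 0\<close> is the leading one.\<close>

locale laplace_series_with_pole =
  fixes b \<tau> :: "nat \<Rightarrow> real" and d :: "nat \<Rightarrow> complex" and m :: nat and H :: "complex \<Rightarrow> complex"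
  assumes b_nonneg [simp]: "0 \<le> b n"
    and summable_laplace: "0 < \<epsilon> \<Longrightarrow> summable (\<lambda>n. b n * exp (- \<epsilon> * \<tau> n))"
    and laplace_eq: "0 < Re z \<Longrightarrow>
      (\<Sum>n. of_real (b n) * exp (- z * of_real (\<tau> n))) = (\<Sum>i<m. d i / z ^ (m - i)) + H z"
    and continuous_H: "continuous_on {z. 0 \<le> Re z} H"
    and m_pos: "0 < m"
    and leading_nonzero: "d 0 \<noteq> 0"
begin

definition weight :: "real \<Rightarrow> nat \<Rightarrow> real" where
  "weight T n = b n * exp (- (\<tau> n / T)) * tent_kernel (T - \<tau> n)"

text \<open>The sum is written as an integral over the counting measure so that it fits the general
  Fubini identity and the normalisation to a probability measure.\<close>

definition mass :: "real \<Rightarrow> real" where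
  "mass T = (\<integral>n. weight T n \<partial>count_space UNIV)"

lemma weight_nonneg [simp]: "0 \<le> weight T n"
  by (simp add: weight_def)

lemma mass_nonneg [simp]: "0 \<le> mass T"
  by (simp add: mass_def)

lemma integrable_laplace:
  assumes "0 < T"
  shows "integrable (count_space UNIV) (\<lambda>n. b n * exp (- (\<tau> n / T)))"
  using summable_laplace[of "1 / T"] assms
  by (simp add: integrable_count_space_nat_iff abs_mult)

lemma integrable_weight:
  assumes "0 < T"
  shows "integrable (count_space UNIV) (weight T)"
proof (rule Bochner_Integration.integrable_bound)
  show "integrable (count_space UNIV) (\<lambda>n. 16 * (b n * exp (- (\<tau> n / T))))"
    using integrable_laplace[OF assms] by simp
  show "AE n in count_space UNIV. norm (weight T n) \<le> norm (16 * (b n * exp (- (\<tau> n / T))))"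
  proof (rule AE_I2)
    fix n
    have "b n * exp (- (\<tau> n / T)) * tent_kernel (T - \<tau> n) \<le> b n * exp (- (\<tau> n / T)) * 16"
      by (intro mult_left_mono tent_kernel_le_16) auto
    then show "norm (weight T n) \<le> norm (16 * (b n * exp (- (\<tau> n / T))))"
      by (simp add: weight_def abs_mult mult_ac)
  qed
qed auto

lemma laplace_integral:
  assumes "0 < Re z"
  shows "(\<integral>n. of_real (b n) * exp (- z * of_real (\<tau> n)) \<partial>count_space UNIV) = (\<Sum>i<m. d i / z ^ (m - i)) + H z"
proof -
  have "summable (\<lambda>n. norm (of_real (b n) * exp (- z * of_real (\<tau> n))))"
    using summable_laplace[OF assms] by (simp add: norm_mult)
  then show ?thesis
    using laplace_eq[OF assms] by (subst integral_count_space_nat) (auto simp: integrable_count_space_nat_iff)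
qed

text \<open>The Fubini identity turns the sum into the transform of the pole parts plus that of
  \<open>H\<close>. Only the pole of order \<open>m\<close> reaches the growth
  \<open>T ^ (m - 1)\<close>.\<close>

lemma weight_transform_asymptotics:
  "((\<lambda>T. (\<integral>n. of_real (weight T n) * cis (\<xi> * (T - \<tau> n)) \<partial>count_space UNIV) / of_real T ^ (m - 1))
     \<longlongrightarrow> d 0 * (of_real (exp (- 1) / fact (m - 1)) * (\<integral>u. of_real (tent_kernel u) * cis (\<xi> * u) \<partial>lborel))) at_top"
proof -
  let ?z = "\<lambda>T y. Complex (1 / T) (y + \<xi>)"
  let ?P = "\<lambda>i T. (\<integral>y. of_real (squared_tent y) * (cis (T * (y + \<xi>)) * (1 / ?z T y ^ Suc (m - 1 - i))) \<partial>lborel)"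
  let ?E = "\<lambda>T. (\<integral>y. of_real (squared_tent y) * (cis (T * (y + \<xi>)) * H (?z T y)) \<partial>lborel)"
  let ?J = "\<integral>u. of_real (tent_kernel u) * cis (\<xi> * u) \<partial>lborel"
  define L where "L i = of_real (exp (- 1) / fact (m - 1 - i)) * ?J" for i
  \<comment> \<open>The part of order \<open>m - i\<close> grows like
    \<open>T ^ (m - 1 - i)\<close>, so division by \<open>T ^ (m - 1)\<close> leaves the extra
    factor \<open>1 / T ^ i\<close>, which survives only for \<open>i = 0\<close>.\<close>
  have pole: "((\<lambda>T. d i * (?P i T / of_real T ^ (m - 1 - i)) * of_real (1 / T ^ i)) \<longlongrightarrow> d i * L i * of_real (if i = 0 then 1 else 0)) at_top" for i
    unfolding L_def
  proof (intro tendsto_mult tendsto_const tent_transform_pole_asymptotics tendsto_of_real)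
    show "((\<lambda>T::real. 1 / T ^ i) \<longlongrightarrow> (if i = 0 then 1 else 0)) at_top"
      by (cases "i = 0") (simp, real_asymp)
  qed
  \<comment> \<open>For \<open>m = 1\<close> the power gives no decay, and the limit 0 comes from
    \<open>?E\<close> alone.\<close>
  have "((\<lambda>T. ?E T * of_real (1 / T ^ (m - 1))) \<longlongrightarrow> 0 * of_real (if m - 1 = 0 then 1 else 0)) at_top"
  proof (intro tendsto_mult tent_transform_continuous_vanishes continuous_H tendsto_of_real)
    show "((\<lambda>T::real. 1 / T ^ (m - 1)) \<longlongrightarrow> (if m - 1 = 0 then 1 else 0)) at_top"
      by (cases "m - 1 = 0") (simp, real_asymp)
  qed
  with pole have "((\<lambda>T. (\<Sum>i<m. d i * (?P i T / of_real T ^ (m - 1 - i)) * of_real (1 / T ^ i)) + ?E T * of_real (1 / T ^ (m - 1)))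
     \<longlongrightarrow> (\<Sum>i<m. d i * L i * of_real (if i = 0 then 1 else 0)) + 0 * of_real (if m - 1 = 0 then 1 else 0)) at_top"
    by (intro tendsto_add tendsto_sum)
  also have "(\<Sum>i<m. d i * L i * of_real (if i = 0 then 1 else 0)) + 0 * of_real (if m - 1 = 0 then 1 else 0) = d 0 * L 0"
    using m_pos by (subst sum.remove[of _ 0]) auto
  finally have lim: "((\<lambda>T. (\<Sum>i<m. d i * (?P i T / of_real T ^ (m - 1 - i)) * of_real (1 / T ^ i)) + ?E T * of_real (1 / T ^ (m - 1))) \<longlongrightarrow> d 0 * L 0) at_top" .
  have "\<forall>\<^sub>F T in at_top. (\<Sum>i<m. d i * (?P i T / of_real T ^ (m - 1 - i)) * of_real (1 / T ^ i)) + ?E T * of_real (1 / T ^ (m - 1)) =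
     (\<integral>n. of_real (weight T n) * cis (\<xi> * (T - \<tau> n)) \<partial>count_space UNIV) / of_real T ^ (m - 1)"
    using eventually_gt_at_top[of 0]
  proof eventually_elim
    case (elim T)
    have Re_z: "0 < Re (?z T y)" and z0: "?z T y \<noteq> 0" for y using elim by (auto simp: complex_eq_iff)
    have cont_z: "continuous_on UNIV (?z T)"
      unfolding Complex_eq by (intro continuous_intros)
    have cont_H: "continuous_on UNIV (\<lambda>y. H (?z T y))"
      by (rule continuous_on_compose2[OF continuous_H cont_z]) (use elim in auto)
    have int: "integrable lborel (\<lambda>y. of_real (squared_tent y) * (cis (T * (y + \<xi>)) * f y))"
      if f: "continuous_on UNIV f" for f
    proof -
      have [measurable]: "f \<in> borel_measurable borel" using f by (rule borel_measurable_continuous_onI)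
      have "bounded (f ` {-1..1})"
        by (intro compact_imp_bounded compact_continuous_image continuous_on_subset[OF f]) auto
      then obtain B where "\<forall>y\<in>{-1..1}. norm (f y) \<le> B" by (auto simp: bounded_iff)
      then show ?thesis
        by (intro integrable_squared_tent_mult[where B = B]) (auto simp: norm_mult abs_le_iff)
    qed
    have "(\<integral>n. of_real (weight T n) * cis (\<xi> * (T - \<tau> n)) \<partial>count_space UNIV)
        = (\<integral>n. of_real (b n * exp (- (\<tau> n / T))) * (of_real (tent_kernel (T - \<tau> n)) * cis (\<xi> * (T - \<tau> n))) \<partial>count_space UNIV)"
      by (simp add: weight_def mult_ac)
    also have "\<dots> = (\<integral>y. of_real (squared_tent y) * (cis (T * (y + \<xi>)) *
         (\<integral>n. of_real (b n * exp (- (\<tau> n / T))) * cis (- ((y + \<xi>) * \<tau> n)) \<partial>count_space UNIV)) \<partial>lborel)"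
      by (rule tent_kernel_transform[symmetric])
         (use integrable_laplace[OF elim] in \<open>auto intro!: sigma_finite_measure_count_space simp flip: of_real_mult\<close>)
    also have "\<dots> = (\<integral>y. of_real (squared_tent y) * (cis (T * (y + \<xi>)) * ((\<Sum>i<m. d i / ?z T y ^ (m - i)) + H (?z T y))) \<partial>lborel)"
    proof (intro Bochner_Integration.integral_cong refl arg_cong2[of _ _ _ _ "(*)"])
      fix y
      have "(\<integral>n. of_real (b n * exp (- (\<tau> n / T))) * cis (- ((y + \<xi>) * \<tau> n)) \<partial>count_space UNIV)
         = (\<integral>n. of_real (b n) * exp (- ?z T y * of_real (\<tau> n)) \<partial>count_space UNIV)"
      proof (intro Bochner_Integration.integral_cong refl)
        fix n
        have "- ?z T y * of_real (\<tau> n) = of_real (- (\<tau> n / T)) + \<i> * of_real (- ((y + \<xi>) * \<tau> n))"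
          by (simp add: complex_eq_iff)
        then show "of_real (b n * exp (- (\<tau> n / T))) * cis (- ((y + \<xi>) * \<tau> n)) = of_real (b n) * exp (- ?z T y * of_real (\<tau> n))"
          by (simp only: exp_add exp_of_real cis_conv_exp of_real_mult mult.assoc)
      qed
      then show "(\<integral>n. of_real (b n * exp (- (\<tau> n / T))) * cis (- ((y + \<xi>) * \<tau> n)) \<partial>count_space UNIV)
         = (\<Sum>i<m. d i / ?z T y ^ (m - i)) + H (?z T y)"
        using laplace_integral[OF Re_z] by simp
    qed
    also have "\<dots> = (\<integral>y. (\<Sum>i<m. d i * (of_real (squared_tent y) * (cis (T * (y + \<xi>)) * (1 / ?z T y ^ Suc (m - 1 - i)))))
        + of_real (squared_tent y) * (cis (T * (y + \<xi>)) * H (?z T y)) \<partial>lborel)"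
    proof (intro Bochner_Integration.integral_cong refl)
      fix y
      have "(\<Sum>i<m. d i / ?z T y ^ (m - i)) = (\<Sum>i<m. d i * (1 / ?z T y ^ Suc (m - 1 - i)))"
        by (intro sum.cong refl) (simp add: Suc_diff_Suc)
      then show "of_real (squared_tent y) * (cis (T * (y + \<xi>)) * ((\<Sum>i<m. d i / ?z T y ^ (m - i)) + H (?z T y))) =
        (\<Sum>i<m. d i * (of_real (squared_tent y) * (cis (T * (y + \<xi>)) * (1 / ?z T y ^ Suc (m - 1 - i)))))
        + of_real (squared_tent y) * (cis (T * (y + \<xi>)) * H (?z T y))"
        by (simp only: distrib_left sum_distrib_left) (simp only: mult.left_commute)
    qed
    also have "\<dots> = (\<Sum>i<m. d i * ?P i T) + ?E T"
    proof -
      have int_pole: "integrable lborel (\<lambda>y. of_real (squared_tent y) * (cis (T * (y + \<xi>)) * (1 / ?z T y ^ Suc k)))" for k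
        by (intro int continuous_intros cont_z) (use z0 in auto)
      show ?thesis
        by (subst Bochner_Integration.integral_add, intro Bochner_Integration.integrable_sum integrable_mult_right int_pole,
            intro int cont_H, subst Bochner_Integration.integral_sum, intro integrable_mult_right int_pole,
            simp only: integral_mult_right_zero)
    qed
    finally have eq: "(\<integral>n. of_real (weight T n) * cis (\<xi> * (T - \<tau> n)) \<partial>count_space UNIV) = (\<Sum>i<m. d i * ?P i T) + ?E T" .
    have "d i * (?P i T / of_real T ^ (m - 1 - i)) * of_real (1 / T ^ i) = d i * ?P i T / of_real T ^ (m - 1)" if "i < m" for i
    proof -
      have "complex_of_real T ^ (m - 1) = of_real T ^ (m - 1 - i) * of_real T ^ i"
        using that by (simp flip: power_add)
      then show ?thesis by simp
    qed
    then show ?case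
      unfolding eq add_divide_distrib sum_divide_distrib by (intro arg_cong2[of _ _ _ _ "(+)"] sum.cong) auto
  qed
  from Lim_transform_eventually[OF lim this] show ?thesis by (simp add: L_def)
qed

text \<open>At \<open>\<xi> = 0\<close> the transform is the mass, which is real and non-negative,
  while its normalised limit is \<open>d 0\<close> times a positive constant.\<close>

lemma leading_real: "Im (d 0) = 0"
  and leading_pos: "0 < Re (d 0)"
  and mass_asymptotics:
    "((\<lambda>T. mass T / T ^ (m - 1)) \<longlongrightarrow> Re (d 0) * exp (- 1) / fact (m - 1) * (\<integral>u. tent_kernel u \<partial>lborel)) at_top"
proof -
  define c where "c = exp (- 1) / fact (m - 1) * (\<integral>u. tent_kernel u \<partial>lborel)"
  have c: "0 < c" using integral_tent_kernel_pos by (simp add: c_def)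
  have lim: "((\<lambda>T. complex_of_real (mass T / T ^ (m - 1))) \<longlongrightarrow> d 0 * of_real c) at_top"
    using weight_transform_asymptotics[of 0] by (simp add: mass_def c_def)
  have lim_Re: "((\<lambda>T. mass T / T ^ (m - 1)) \<longlongrightarrow> Re (d 0) * c) at_top"
    using tendsto_Re[OF lim] by simp
  then show "((\<lambda>T. mass T / T ^ (m - 1)) \<longlongrightarrow> Re (d 0) * exp (- 1) / fact (m - 1) * (\<integral>u. tent_kernel u \<partial>lborel)) at_top"
    by (simp add: c_def mult_ac)
  have "((\<lambda>T::real. 0) \<longlongrightarrow> Im (d 0) * c) at_top"
    using tendsto_Im[OF lim] by simp
  then have "Im (d 0) * c = 0"
    using tendsto_unique[OF trivial_limit_at_top_linorder _ tendsto_const] by metis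
  then show Im: "Im (d 0) = 0" using c by simp
  have "0 \<le> Re (d 0) * c"
    by (rule tendsto_lowerbound[OF lim_Re]) (auto intro!: eventually_mono[OF eventually_gt_at_top[of 0]])
  then have "0 \<le> Re (d 0)" using c by (simp add: zero_le_mult_iff)
  moreover have "Re (d 0) \<noteq> 0" using leading_nonzero Im by (auto simp: complex_eq_iff)
  ultimately show "0 < Re (d 0)" by simp
qed

lemma mass_eventually_pos: "\<forall>\<^sub>F T in at_top. 0 < mass T"
proof -
  have "0 < Re (d 0) * exp (- 1) / fact (m - 1) * (\<integral>u. tent_kernel u \<partial>lborel)"
    using leading_pos integral_tent_kernel_pos by simp
  from order_tendstoD(1)[OF mass_asymptotics this] eventually_gt_at_top[of 0] show ?thesis
    by eventually_elim (simp add: zero_less_divide_iff)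
qed

section \<open>Normalised probability measures and Levy's continuity theorem\<close>

definition weight_distr :: "real \<Rightarrow> real measure" where
  "weight_distr T = distr (density (count_space UNIV) (\<lambda>n. weight T n / mass T)) borel (\<lambda>n. T - \<tau> n)"

lemma real_distribution_weight_distr:
  assumes "0 < T" "0 < mass T"
  shows "real_distribution (weight_distr T)"
proof -
  have "(\<integral>\<^sup>+n. ennreal (weight T n / mass T) \<partial>count_space UNIV) = ennreal (\<integral>n. weight T n / mass T \<partial>count_space UNIV)"
    by (rule nn_integral_eq_integral) (use integrable_weight assms in auto)
  also have "\<dots> = 1" using assms by (simp add: mass_def[symmetric])
  finally have "prob_space (density (count_space UNIV) (\<lambda>n. weight T n / mass T))"
    by (intro prob_spaceI) (simp add: emeasure_density)
  then show ?thesis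
    unfolding weight_distr_def by (rule prob_space.real_distribution_distr) simp
qed

lemma integral_weight_distr:
  fixes f :: "real \<Rightarrow> 'a::{banach, second_countable_topology}"
  assumes "f \<in> borel_measurable borel"
  shows "(\<integral>u. f u \<partial>weight_distr T) = (\<integral>n. (weight T n / mass T) *\<^sub>R f (T - \<tau> n) \<partial>count_space UNIV)"
  unfolding weight_distr_def using assms by (simp add: integral_distr integral_density)

definition kernel_distr :: "real measure" where
  "kernel_distr = density lborel (\<lambda>u. tent_kernel u / (\<integral>u. tent_kernel u \<partial>lborel))"

lemma real_distribution_kernel_distr: "real_distribution kernel_distr"
proof -
  have "(\<integral>\<^sup>+u. ennreal (tent_kernel u / (\<integral>u. tent_kernel u \<partial>lborel)) \<partial>lborel) =
      ennreal (\<integral>u. tent_kernel u / (\<integral>u. tent_kernel u \<partial>lborel) \<partial>lborel)"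
    by (rule nn_integral_eq_integral) (use integrable_tent_kernel in auto)
  also have "\<dots> = 1" using integral_tent_kernel_pos by simp
  finally have "prob_space kernel_distr"
    unfolding kernel_distr_def by (intro prob_spaceI) (simp add: emeasure_density)
  then show ?thesis
    by (auto simp: real_distribution_def real_distribution_axioms_def kernel_distr_def)
qed

lemma integral_kernel_distr:
  fixes f :: "real \<Rightarrow> 'a::{banach, second_countable_topology}"
  assumes "f \<in> borel_measurable borel"
  shows "(\<integral>u. f u \<partial>kernel_distr) = (\<integral>u. (tent_kernel u / (\<integral>u. tent_kernel u \<partial>lborel)) *\<^sub>R f u \<partial>lborel)"
  unfolding kernel_distr_def using assms by (simp add: integral_density)

text \<open>Dividing the asymptotics at \<open>\<xi>\<close> by those of the mass cancels both the
  growth \<open>T ^ (m - 1)\<close> and the leading coefficient; the normalised transform of the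
  kernel remains.\<close>

lemma char_weight_distr_tendsto:
  "((\<lambda>T. char (weight_distr T) \<xi>) \<longlongrightarrow> char kernel_distr \<xi>) at_top"
proof -
  let ?J = "\<integral>u. of_real (tent_kernel u) * cis (\<xi> * u) \<partial>lborel"
  let ?\<kappa> = "\<integral>u. tent_kernel u \<partial>lborel"
  define c where "c = Re (d 0) * exp (- 1) / fact (m - 1)"
  have d0: "d 0 = of_real (Re (d 0))" using leading_real by (simp add: complex_eq_iff)
  have c: "c > 0" using leading_pos by (simp add: c_def)
  have kappa: "?\<kappa> > 0" by (rule integral_tent_kernel_pos)
  let ?S = "\<lambda>T. \<integral>n. of_real (weight T n) * cis (\<xi> * (T - \<tau> n)) \<partial>count_space UNIV"
  have "((\<lambda>T. ?S T / of_real T ^ (m - 1)) \<longlongrightarrow> of_real c * ?J) at_top"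
    using weight_transform_asymptotics[of \<xi>] by (subst (asm) d0) (simp add: c_def mult.assoc)
  moreover have "((\<lambda>T. complex_of_real (mass T / T ^ (m - 1))) \<longlongrightarrow> of_real (c * ?\<kappa>)) at_top"
    using mass_asymptotics unfolding c_def by (rule tendsto_of_real)
  ultimately have "((\<lambda>T. (?S T / of_real T ^ (m - 1)) / of_real (mass T / T ^ (m - 1))) \<longlongrightarrow> (of_real c * ?J) / of_real (c * ?\<kappa>)) at_top"
    by (rule tendsto_divide) (use c kappa in auto)
  also have "(of_real c * ?J) / of_real (c * ?\<kappa>) = ?J / of_real ?\<kappa>"
    using c by simp
  also have "\<dots> = (\<integral>u. of_real (tent_kernel u) * cis (\<xi> * u) / of_real ?\<kappa> \<partial>lborel)" by simp
  also have "\<dots> = char kernel_distr \<xi>"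
    unfolding char_def by (subst integral_kernel_distr) (auto simp: cis_conv_exp scaleR_conv_of_real)
  finally have "((\<lambda>T. (?S T / of_real T ^ (m - 1)) / of_real (mass T / T ^ (m - 1))) \<longlongrightarrow> char kernel_distr \<xi>) at_top" .
  moreover have "\<forall>\<^sub>F T in at_top. (?S T / of_real T ^ (m - 1)) / of_real (mass T / T ^ (m - 1)) = char (weight_distr T) \<xi>"
    using eventually_gt_at_top[of 0]
  proof eventually_elim
    case (elim T)
    have "(?S T / of_real T ^ (m - 1)) / of_real (mass T / T ^ (m - 1)) = ?S T / of_real (mass T)"
      using elim by simp
    also have "\<dots> = (\<integral>n. of_real (weight T n) * cis (\<xi> * (T - \<tau> n)) / of_real (mass T) \<partial>count_space UNIV)" by simp
    also have "\<dots> = char (weight_distr T) \<xi>"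
      unfolding char_def by (subst integral_weight_distr) (auto simp: cis_conv_exp scaleR_conv_of_real)
    finally show ?case .
  qed
  ultimately show ?thesis by (rule Lim_transform_eventually)
qed

text \<open>Levy's theorem yields weak convergence along every sequence tending to infinity. The
  limit measure has a density, so finitely many discontinuities form a null set for it.\<close>

lemma integral_weight_distr_tendsto:
  fixes f :: "real \<Rightarrow> real"
  assumes f [measurable]: "f \<in> borel_measurable borel" and bdd: "\<And>u. norm (f u) \<le> B"
    and cont: "finite {u. \<not> isCont f u}"
  shows "((\<lambda>T. \<integral>u. f u \<partial>weight_distr T) \<longlongrightarrow> (\<integral>u. f u \<partial>kernel_distr)) at_top"
proof (rule tendsto_at_topI_sequentially)
  fix X :: "nat \<Rightarrow> real" assume X: "filterlim X at_top sequentially"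
  have "\<forall>\<^sub>F T in at_top. 0 < T \<and> 0 < mass T"
    by (intro eventually_conj mass_eventually_pos eventually_gt_at_top)
  then have "\<forall>\<^sub>F n in sequentially. 0 < X n \<and> 0 < mass (X n)"
    by (rule eventually_compose_filterlim[OF _ X])
  \<comment> \<open>Levy's theorem needs every member of the sequence to be a probability measure,
    so the initial terms, where the mass may vanish, are dropped.\<close>
  then obtain N where N: "\<And>n. 0 < X (n + N) \<and> 0 < mass (X (n + N))"
    unfolding eventually_sequentially by (metis le_add2)
  define Y where "Y n = X (n + N)" for n
  have Y: "filterlim Y at_top sequentially"
    unfolding Y_def by (rule filterlim_compose[OF X filterlim_add_const_nat_at_top])
  have "(\<lambda>n. \<integral>u. f u \<partial>weight_distr (Y n)) \<longlonglongrightarrow> (\<integral>u. f u \<partial>kernel_distr)"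
  proof (rule weak_conv_imp_bdd_ae_continuous_conv)
    show distr: "real_distribution (weight_distr (Y n))" for n
      using N by (intro real_distribution_weight_distr) (auto simp: Y_def)
    show "real_distribution kernel_distr" by (rule real_distribution_kernel_distr)
    show "weak_conv_m (\<lambda>n. weight_distr (Y n)) kernel_distr"
      by (intro levy_continuity distr real_distribution_kernel_distr
            filterlim_compose[OF char_weight_distr_tendsto Y])
    show "emeasure kernel_distr {u. \<not> isCont f u} = 0"
      unfolding kernel_distr_def
      by (rule absolutely_continuousI_density[unfolded absolutely_continuous_def, THEN subsetD, THEN null_setsD1])
         (use finite_imp_null_set_lborel[OF cont] in auto)
  qed (use bdd in auto)
  then show "(\<lambda>n. \<integral>u. f u \<partial>weight_distr (X n)) \<longlonglongrightarrow> (\<integral>u. f u \<partial>kernel_distr)"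
    unfolding Y_def by (rule LIMSEQ_offset)
qed

end

section \<open>From weak convergence to exponential sums\<close>

context laplace_series_with_pole
begin

text \<open>When \<open>b n = a n * exp (- \<alpha> * \<tau> n)\<close>, the integral is
  \<open>exp (- \<alpha> * T)\<close> times the sum of \<open>a n\<close> over
  \<open>\<tau> n \<le> T\<close>, the quantity sought.\<close>

lemma exponential_sum_asymptotics:
  assumes \<alpha>: "0 < \<alpha>"
  shows "((\<lambda>T. (\<integral>n. b n * (if \<tau> n \<le> T then exp (- \<alpha> * (T - \<tau> n)) else 0) \<partial>count_space UNIV) / T ^ (m - 1))
    \<longlongrightarrow> Re (d 0) / (\<alpha> * fact (m - 1))) at_top"
proof -
  \<comment> \<open>Division by the positive kernel turns integrals of exponentials against the original weights into
    integrals of a bounded function, discontinuous only at 0, against \<open>weight_distr\<close>.\<close>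
  define q where "q u = indicator {0..} u * exp (- \<alpha> * u) / tent_kernel u" for u
  let ?\<kappa> = "\<integral>u. tent_kernel u \<partial>lborel"
  have [measurable]: "q \<in> borel_measurable borel" unfolding q_def[abs_def] by measurable
  have q_nonneg: "0 \<le> q u" for u by (simp add: q_def)
  obtain c where c: "c > 0" "\<And>u. c \<le> (1 + u\<^sup>2) * tent_kernel u" using tent_kernel_lower_bound by blast
  have power_exp: "u ^ j * exp (- \<alpha> * u) \<le> fact j / \<alpha> ^ j" if "0 \<le> u" for u j
    using power_exp_le_fact[of "\<alpha> * u" j] \<alpha> that by (simp add: power_mult_distrib field_simps)
  have q_le: "q u \<le> (1 + u\<^sup>2) * exp (- \<alpha> * u) / c" if "0 \<le> u" for u
  proof -
    have "exp (- \<alpha> * u) * c \<le> exp (- \<alpha> * u) * ((1 + u\<^sup>2) * tent_kernel u)"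
      by (intro mult_left_mono c) auto
    then show ?thesis using that c(1) by (simp add: q_def field_simps)
  qed
  have q_bdd: "q u \<le> (1 + 2 / \<alpha>\<^sup>2) / c" for u
  proof (cases "0 \<le> u")
    case True
    have "(1 + u\<^sup>2) * exp (- \<alpha> * u) \<le> 1 + 2 / \<alpha>\<^sup>2"
      using add_mono[OF power_exp[OF True, of 0] power_exp[OF True, of 2]]
      by (simp add: distrib_right fact_numeral)
    with q_le[OF True] show ?thesis using c(1) by (meson divide_right_mono less_imp_le order_trans)
  qed (use c(1) in \<open>simp add: q_def\<close>)
  \<comment> \<open>The additional factor \<open>u\<close> controls the error made below when
    \<open>exp (- (u / T))\<close> is replaced by 1.\<close>
  have uq_bdd: "u * q u \<le> (1 / \<alpha> + 6 / \<alpha> ^ 3) / c" for u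
  proof (cases "0 \<le> u")
    case True
    have "u * ((1 + u\<^sup>2) * exp (- \<alpha> * u)) \<le> 1 / \<alpha> + 6 / \<alpha> ^ 3"
      using add_mono[OF power_exp[OF True, of 1] power_exp[OF True, of 3]]
      by (simp add: algebra_simps fact_numeral power2_eq_square power3_eq_cube)
    moreover have "u * q u \<le> u * ((1 + u\<^sup>2) * exp (- \<alpha> * u)) / c"
      using mult_left_mono[OF q_le[OF True] True] by simp
    ultimately show ?thesis using c(1) by (meson divide_right_mono less_imp_le order_trans)
  qed (use c(1) \<alpha> in \<open>simp add: q_def\<close>)
  have uq_nonneg: "0 \<le> u * q u" for u by (simp add: q_def indicator_def)
  have "{u. \<not> isCont q u} \<subseteq> {0}"
  proof -
    have "isCont q u" if "u \<noteq> 0" for u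
    proof (cases "0 < u")
      case True
      have "isCont (\<lambda>u. exp (- \<alpha> * u) / tent_kernel u) u"
        by (intro continuous_intros isCont_tent_kernel) simp
      moreover have "\<forall>\<^sub>F x in nhds u. q x = exp (- \<alpha> * x) / tent_kernel x"
        using eventually_nhds_in_open[of "{0<..}" u] True by (auto elim!: eventually_mono simp: q_def)
      ultimately show ?thesis by (simp add: isCont_cong)
    next
      case False
      have "\<forall>\<^sub>F x in nhds u. q x = 0"
        using eventually_nhds_in_open[of "{..<0}" u] that False by (auto elim!: eventually_mono simp: q_def)
      then show ?thesis by (simp add: isCont_cong)
    qed
    then show ?thesis by auto
  qed
  then have "finite {u. \<not> isCont q u}" by (rule finite_subset) simp
  then have lim_q: "((\<lambda>T. \<integral>u. q u \<partial>weight_distr T) \<longlongrightarrow> (\<integral>u. q u \<partial>kernel_distr)) at_top"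
    by (intro integral_weight_distr_tendsto[where B = "(1 + 2 / \<alpha>\<^sup>2) / c"]) (auto simp: q_nonneg q_bdd)
  have "(\<integral>u. q u \<partial>kernel_distr) = (\<integral>u. indicator {0..} u * exp (- \<alpha> * u) / ?\<kappa> \<partial>lborel)"
    by (subst integral_kernel_distr) (auto simp: q_def)
  also have "\<dots> = (\<integral>u. indicator {0..} u * exp (- \<alpha> * u) \<partial>lborel) / ?\<kappa>" by simp
  also have "(\<integral>u. indicator {0..} u * exp (- \<alpha> * u) \<partial>lborel) = 1 / \<alpha>"
  proof -
    have "complex_of_real (\<integral>u. indicator {0..} u * exp (- \<alpha> * u) \<partial>lborel) =
       (\<integral>u. indicator {0..} u *\<^sub>R (of_real u ^ 0 * exp (- of_real \<alpha> * of_real u)) \<partial>lborel)"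
      unfolding integral_complex_of_real[symmetric]
      by (intro Bochner_Integration.integral_cong) (auto simp: indicator_def exp_of_real[symmetric])
    also have "\<dots> = of_real (1 / \<alpha>)" using \<alpha> by (subst laplace_power) auto
    finally show ?thesis by (simp only: of_real_eq_iff)
  qed
  finally have int_q: "(\<integral>u. q u \<partial>kernel_distr) = 1 / \<alpha> / ?\<kappa>" .

  \<comment> \<open>With \<open>u = T - \<tau> n\<close>, the damping in \<open>weight\<close>
    equals \<open>exp (- 1) * exp (u / T)\<close>; the factor \<open>exp (- (u / T))\<close> cancels
    its variable part. Since \<open>1 - exp (- (u / T)) \<le> u / T\<close>, inserting this factor
    changes the integral by \<open>O(1 / T)\<close> only.\<close>
  have lim_damped: "((\<lambda>T. \<integral>u. exp (- (u / T)) * q u \<partial>weight_distr T) \<longlongrightarrow> 1 / \<alpha> / ?\<kappa>) at_top"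
  proof (rule Lim_transform2)
    show "((\<lambda>T. \<integral>u. q u \<partial>weight_distr T) \<longlongrightarrow> 1 / \<alpha> / ?\<kappa>) at_top"
      using lim_q by (simp only: int_q)
    have "\<forall>\<^sub>F T in at_top. norm ((\<integral>u. q u \<partial>weight_distr T) - (\<integral>u. exp (- (u / T)) * q u \<partial>weight_distr T))
        \<le> (1 / \<alpha> + 6 / \<alpha> ^ 3) / c / T"
      using eventually_gt_at_top[of 0] mass_eventually_pos
    proof eventually_elim
      case (elim T)
      interpret P: real_distribution "weight_distr T"
        using elim by (rule real_distribution_weight_distr)
      have damped_le: "0 \<le> (1 - exp (- (u / T))) * q u \<and> (1 - exp (- (u / T))) * q u \<le> (1 / \<alpha> + 6 / \<alpha> ^ 3) / c / T" for u
      proof (cases "0 \<le> u")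
        case True
        have "0 \<le> 1 - exp (- (u / T))" "1 - exp (- (u / T)) \<le> u / T"
          using True elim exp_ge_add_one_self[of "- (u / T)"] by auto
        then have "0 \<le> (1 - exp (- (u / T))) * q u" "(1 - exp (- (u / T))) * q u \<le> u * q u / T"
          using mult_right_mono[OF _ q_nonneg[of u], of "1 - exp (- (u / T))" "u / T"] q_nonneg[of u] by auto
        moreover have "u * q u / T \<le> (1 / \<alpha> + 6 / \<alpha> ^ 3) / c / T"
          using uq_bdd elim by (intro divide_right_mono) auto
        ultimately show ?thesis by linarith
      qed (use elim c(1) \<alpha> in \<open>simp add: q_def\<close>)
      have int1: "integrable (weight_distr T) q"
        by (rule P.integrable_const_bound[where B = "(1 + 2 / \<alpha>\<^sup>2) / c"]) (auto simp: q_nonneg q_bdd)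
      have int2: "integrable (weight_distr T) (\<lambda>u. (1 - exp (- (u / T))) * q u)"
      proof (rule P.integrable_const_bound)
        show "AE u in weight_distr T. norm ((1 - exp (- (u / T))) * q u) \<le> (1 / \<alpha> + 6 / \<alpha> ^ 3) / c / T"
          using damped_le by (intro AE_I2) (simp only: real_norm_def abs_of_nonneg)
      qed simp
      have "(\<integral>u. exp (- (u / T)) * q u \<partial>weight_distr T) = (\<integral>u. q u - (1 - exp (- (u / T))) * q u \<partial>weight_distr T)"
        by (simp add: algebra_simps)
      then have "(\<integral>u. q u \<partial>weight_distr T) - (\<integral>u. exp (- (u / T)) * q u \<partial>weight_distr T)
         = (\<integral>u. (1 - exp (- (u / T))) * q u \<partial>weight_distr T)"
        using int1 int2 by simp
      moreover have "0 \<le> (\<integral>u. (1 - exp (- (u / T))) * q u \<partial>weight_distr T)"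
        using damped_le by (intro Bochner_Integration.integral_nonneg) auto
      moreover have "(\<integral>u. (1 - exp (- (u / T))) * q u \<partial>weight_distr T) \<le> (1 / \<alpha> + 6 / \<alpha> ^ 3) / c / T"
        using damped_le by (intro P.integral_le_const int2) auto
      ultimately show ?case by simp
    qed
    moreover have "((\<lambda>T. (1 / \<alpha> + 6 / \<alpha> ^ 3) / c / T) \<longlongrightarrow> 0) at_top"
      by real_asymp
    ultimately show "((\<lambda>T. (\<integral>u. q u \<partial>weight_distr T) - (\<integral>u. exp (- (u / T)) * q u \<partial>weight_distr T)) \<longlongrightarrow> 0) at_top"
      by (rule Lim_null_comparison)
  qed
  \<comment> \<open>The factor \<open>exp 1\<close> undoes the constant part of the damping, and
    \<open>mass T\<close> undoes the normalisation.\<close>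
  have "((\<lambda>T. exp 1 * (mass T / T ^ (m - 1)) * (\<integral>u. exp (- (u / T)) * q u \<partial>weight_distr T)) \<longlongrightarrow>
     exp 1 * (Re (d 0) * exp (- 1) / fact (m - 1) * ?\<kappa>) * (1 / \<alpha> / ?\<kappa>)) at_top"
    by (intro tendsto_mult tendsto_const mass_asymptotics lim_damped)
  also have "exp 1 * (Re (d 0) * exp (- 1) / fact (m - 1) * ?\<kappa>) * (1 / \<alpha> / ?\<kappa>) = Re (d 0) / (\<alpha> * fact (m - 1))"
    using integral_tent_kernel_pos \<alpha> by (simp add: exp_minus field_simps)
  finally have lim: "((\<lambda>T. exp 1 * (mass T / T ^ (m - 1)) * (\<integral>u. exp (- (u / T)) * q u \<partial>weight_distr T)) \<longlongrightarrow> Re (d 0) / (\<alpha> * fact (m - 1))) at_top" .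
  have "\<forall>\<^sub>F T in at_top. exp 1 * (mass T / T ^ (m - 1)) * (\<integral>u. exp (- (u / T)) * q u \<partial>weight_distr T) =
     (\<integral>n. b n * (if \<tau> n \<le> T then exp (- \<alpha> * (T - \<tau> n)) else 0) \<partial>count_space UNIV) / T ^ (m - 1)"
    using eventually_gt_at_top[of 0] mass_eventually_pos
  proof eventually_elim
    case (elim T)
    have eq: "exp 1 * mass T * ((weight T n / mass T) *\<^sub>R (exp (- ((T - \<tau> n) / T)) * q (T - \<tau> n))) =
       b n * (if \<tau> n \<le> T then exp (- \<alpha> * (T - \<tau> n)) else 0)" for n
    proof -
      have "exp 1 * (exp (- (\<tau> n / T)) * exp (- ((T - \<tau> n) / T))) = 1"
        using elim by (simp add: exp_add[symmetric] field_simps)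
      then have "exp 1 * mass T * ((weight T n / mass T) *\<^sub>R (exp (- ((T - \<tau> n) / T)) * q (T - \<tau> n))) =
        b n * (tent_kernel (T - \<tau> n) * q (T - \<tau> n))"
        using elim by (simp add: weight_def field_simps)
      then show ?thesis by (simp add: q_def indicator_def)
    qed
    have "exp 1 * mass T * (\<integral>u. exp (- (u / T)) * q u \<partial>weight_distr T) =
       (\<integral>n. b n * (if \<tau> n \<le> T then exp (- \<alpha> * (T - \<tau> n)) else 0) \<partial>count_space UNIV)"
      by (subst integral_weight_distr) (simp, simp only: integral_mult_right_zero[symmetric] eq)
    then show ?case by simp
  qed
  with lim show ?thesis by (rule Lim_transform_eventually)
qed

end

section \<open>Application to the Dirichlet series\<close>

text \<open>The coefficients of \<open>pcompose g [:a, 1:]\<close> are the Taylor coefficients of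
  \<open>g\<close> at \<open>a\<close>; the degree bound leaves negative powers of \<open>z\<close>
  only.\<close>

lemma poly_over_power_principal_part:
  fixes g :: "'a::field poly"
  assumes "degree g < m" "z \<noteq> 0"
  shows "poly g (a + z) / z ^ m = (\<Sum>i<m. coeff (pcompose g [:a, 1:]) i / z ^ (m - i))"
proof -
  have "poly g (a + z) = poly (pcompose g [:a, 1:]) z" by (simp add: poly_pcompose)
  also have "\<dots> = (\<Sum>i<m. coeff (pcompose g [:a, 1:]) i * z ^ i)"
    unfolding poly_altdef using assms(1)
    by (intro sum.mono_neutral_left) (auto simp: degree_pcompose coeff_eq_0)
  finally show ?thesis
    using assms(2) by (auto simp: sum_divide_distrib power_diff intro!: sum.cong)
qed

theorem theoremA:
  fixes l a :: "nat \<Rightarrow> real"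
    and \<alpha> :: real
    and m :: nat
    and g :: "complex poly"
    and h :: "complex \<Rightarrow> complex"
  assumes "1 \<le> l 0"
    and "strict_mono l"
    and "filterlim l at_top sequentially"
    and "\<And>n. a n \<ge> 0"
    and "\<alpha> > 0"
    and "m \<ge> 1"
    and "\<And>s. Re s > \<alpha> \<Longrightarrow> summable (dirichlet_term a l s)"
    and "\<And>s. Re s > \<alpha> \<Longrightarrow>
           dirichlet_sum a l s = poly g s / (s - complex_of_real \<alpha>) ^ m + h s"
    and "degree g \<le> m - 1"
    and "poly g (complex_of_real \<alpha>) \<noteq> 0"
    and "holomorphic_with_continuous_extension \<alpha> h"
  shows "\<exists>c :: real.
     ((\<lambda>s. (s - complex_of_real \<alpha>) ^ m * dirichlet_sum a l s / (complex_of_real \<alpha> * fact (m - 1)))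
        \<longlongrightarrow> complex_of_real c) (at (complex_of_real \<alpha>) within {s. Re s > \<alpha>}) \<and>
     (\<lambda>x :: real. \<Sum>n | l n \<le> x. a n) \<sim>[at_top] (\<lambda>x. c * x powr \<alpha> * ln x ^ (m - 1))"
proof -
  obtain H where H: "continuous_on {s. Re s \<ge> \<alpha>} H" "\<And>s. Re s > \<alpha> \<Longrightarrow> H s = h s"
    using assms(11) by (auto simp: holomorphic_with_continuous_extension_def)
  have l_pos: "0 < l n" for n
    using assms(1) strict_mono_leD[OF assms(2), of 0 n] by simp
  define b where "b n = a n * l n powr (- \<alpha>)" for n
  define \<tau> where "\<tau> n = ln (l n)" for n
  define d where "d = coeff (pcompose g [:complex_of_real \<alpha>, 1:])"
  have d0: "d 0 = poly g (complex_of_real \<alpha>)"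
    by (simp add: d_def flip: poly_0_coeff_0) (simp add: poly_pcompose)
  \<comment> \<open>Shifting by \<open>\<alpha>\<close> moves the pole to the origin and absorbs
    \<open>l n powr (- \<alpha>)\<close> into \<open>b n\<close>.\<close>
  have term_eq: "dirichlet_term a l (of_real \<alpha> + z) n = of_real (b n) * exp (- z * of_real (\<tau> n))" for z n
    using l_pos[of n]
    by (simp add: dirichlet_term_def b_def \<tau>_def powr_def Ln_of_real exp_of_real[symmetric] exp_add[symmetric] algebra_simps)
  interpret laplace_series_with_pole b \<tau> d m "\<lambda>z. H (of_real \<alpha> + z)"
  proof
    show "0 \<le> b n" for n using assms(4) by (simp add: b_def)
    show "summable (\<lambda>n. b n * exp (- \<epsilon> * \<tau> n))" if "0 < \<epsilon>" for \<epsilon>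
    proof -
      have "summable (\<lambda>n. complex_of_real (b n * exp (- \<epsilon> * \<tau> n)))"
        using assms(7)[of "of_real \<alpha> + of_real \<epsilon>"] that by (simp add: term_eq[abs_def] exp_of_real[symmetric])
      then show ?thesis by (simp only: summable_complex_of_real)
    qed
    show "(\<Sum>n. of_real (b n) * exp (- z * of_real (\<tau> n))) = (\<Sum>i<m. d i / z ^ (m - i)) + H (of_real \<alpha> + z)" if "0 < Re z" for z
    proof -
      have "z \<noteq> 0" using that by auto
      moreover have "degree g < m" using assms(6,9) by simp
      ultimately show ?thesis
        using assms(8)[of "of_real \<alpha> + z"] H(2)[of "of_real \<alpha> + z"] that
        by (simp add: dirichlet_sum_def term_eq poly_over_power_principal_part d_def)
    qed
    show "continuous_on {z. 0 \<le> Re z} (\<lambda>z. H (of_real \<alpha> + z))"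
      by (rule continuous_on_compose2[OF H(1)]) (auto intro!: continuous_intros)
    show "0 < m" using assms(6) by simp
    show "d 0 \<noteq> 0" using assms(10) by (simp add: d0)
  qed
  define c where "c = Re (d 0) / (\<alpha> * fact (m - 1))"
  have c: "c > 0" using leading_pos assms(5) by (simp add: c_def)
  show ?thesis
  proof (intro exI[of _ c] conjI)
    let ?F = "at (complex_of_real \<alpha>) within {s. Re s > \<alpha>}"
    have "(H \<longlongrightarrow> H (of_real \<alpha>)) (at (of_real \<alpha>) within {s. Re s \<ge> \<alpha>})"
      using H(1) by (simp add: continuous_on_def)
    then have "(H \<longlongrightarrow> H (of_real \<alpha>)) ?F"
      by (rule tendsto_within_subset) auto
    \<comment> \<open>Multiplied by \<open>(s - \<alpha>) ^ m\<close>, the series becomes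
      \<open>g\<close> plus a term that vanishes at \<open>\<alpha>\<close>, because
      \<open>H\<close> has a finite limit there and \<open>m\<close> is positive.\<close>
    then have "((\<lambda>s. (poly g s + (s - of_real \<alpha>) ^ m * H s) / (of_real \<alpha> * fact (m - 1))) \<longlongrightarrow>
       (poly g (of_real \<alpha>) + (of_real \<alpha> - of_real \<alpha>) ^ m * H (of_real \<alpha>)) / (of_real \<alpha> * fact (m - 1))) ?F"
      by (intro tendsto_intros) (use assms(5) in auto)
    also have "(poly g (of_real \<alpha>) + (of_real \<alpha> - of_real \<alpha>) ^ m * H (of_real \<alpha>)) / (of_real \<alpha> * fact (m - 1)) = of_real c"
      using m_pos leading_real by (simp add: c_def d0[symmetric] complex_is_Real_iff zero_power)
    finally have lim: "((\<lambda>s. (poly g s + (s - of_real \<alpha>) ^ m * H s) / (of_real \<alpha> * fact (m - 1))) \<longlongrightarrow> of_real c) ?F" .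
    have "\<forall>\<^sub>F s in ?F. (poly g s + (s - of_real \<alpha>) ^ m * H s) / (of_real \<alpha> * fact (m - 1)) =
       (s - of_real \<alpha>) ^ m * dirichlet_sum a l s / (of_real \<alpha> * fact (m - 1))"
      unfolding eventually_at_filter
    proof (intro always_eventually allI impI)
      fix s assume s: "s \<noteq> complex_of_real \<alpha>" "s \<in> {s. Re s > \<alpha>}"
      then show "(poly g s + (s - of_real \<alpha>) ^ m * H s) / (of_real \<alpha> * fact (m - 1)) =
        (s - of_real \<alpha>) ^ m * dirichlet_sum a l s / (of_real \<alpha> * fact (m - 1))"
        using assms(8)[of s] H(2)[of s] by (simp add: distrib_left)
    qed
    with lim show "((\<lambda>s. (s - of_real \<alpha>) ^ m * dirichlet_sum a l s / (of_real \<alpha> * fact (m - 1))) \<longlongrightarrow> of_real c) ?F"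
      by (rule Lim_transform_eventually)
  next
    \<comment> \<open>The exponential sum is taken at \<open>T = ln x\<close>, where
      \<open>exp (\<alpha> * T)\<close> is \<open>x powr \<alpha>\<close>.\<close>
    have "((\<lambda>x. (\<integral>n. b n * (if \<tau> n \<le> ln x then exp (- \<alpha> * (ln x - \<tau> n)) else 0) \<partial>count_space UNIV) / ln x ^ (m - 1)) \<longlongrightarrow> c) at_top"
      unfolding c_def by (rule filterlim_compose[OF exponential_sum_asymptotics[OF assms(5)] ln_at_top])
    moreover have "\<forall>\<^sub>F x in at_top. (\<integral>n. b n * (if \<tau> n \<le> ln x then exp (- \<alpha> * (ln x - \<tau> n)) else 0) \<partial>count_space UNIV) / ln x ^ (m - 1)
        = (\<Sum>n | l n \<le> x. a n) / (x powr \<alpha> * ln x ^ (m - 1))"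
      using eventually_gt_at_top[of 0]
    proof eventually_elim
      case (elim x)
      have "\<forall>\<^sub>F n in sequentially. x < l n" using assms(3) by (simp add: filterlim_at_top_dense)
      then have fin: "finite {n. l n \<le> x}"
        unfolding eventually_sequentially
        by (metis (no_types, lifting) finite_nat_set_iff_bounded linorder_not_le mem_Collect_eq)
      have eq: "b n * (if \<tau> n \<le> ln x then exp (- \<alpha> * (ln x - \<tau> n)) else 0) = (if l n \<le> x then a n / x powr \<alpha> else 0)" for n
        using l_pos[of n] elim
        by (auto simp: b_def \<tau>_def powr_def exp_minus exp_diff algebra_simps exp_add)
      have "(\<integral>n. (if l n \<le> x then a n / x powr \<alpha> else 0) \<partial>count_space UNIV) = (\<Sum>n | l n \<le> x. a n / x powr \<alpha>)"
        by (subst lebesgue_integral_count_space_finite_support)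
           (auto intro: finite_subset[OF _ fin] intro!: sum.mono_neutral_cong_left fin)
      then show ?case by (simp only: eq) (simp add: sum_divide_distrib)
    qed
    ultimately have "((\<lambda>x. (\<Sum>n | l n \<le> x. a n) / (x powr \<alpha> * ln x ^ (m - 1))) \<longlongrightarrow> c) at_top"
      by (rule Lim_transform_eventually)
    \<comment> \<open>A limit of the quotient gives asymptotic equivalence because \<open>c\<close>
      is nonzero, which rests on the positivity of the leading coefficient.\<close>
    then have "(\<lambda>x. \<Sum>n | l n \<le> x. a n) \<sim>[at_top] (\<lambda>x. c * (x powr \<alpha> * ln x ^ (m - 1)))"
      by (rule asymp_equivI'_const) (use c in simp)
    then show "(\<lambda>x. \<Sum>n | l n \<le> x. a n) \<sim>[at_top] (\<lambda>x. c * x powr \<alpha> * ln x ^ (m - 1))"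
      by (simp add: mult.assoc)
  qed
qed

end
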